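(* Suppose the standing assumptions on (P) (items (i)–(iv) of the context) hold, the core function is $$K^{k}(u)=\sum_{i=1}^{N}\frac{\theta_{i}}{2}\Big\|A_{i}u_{i}+\Big(\sum_{j\neq i}A_{j}u_{j}^{k}-b\Big)\Big\|^{2}+\sum_{i=1}^N\frac{\alpha_i}{2}\|P_iu_i\|^2,\qquad \theta_i\ge0,\ \alpha_i\ge0,$$ and for each index $i=1,\dots,N$ either $A_i$ has full column rank with $\theta_i>0$, or $P_i$ has full column rank with $\alpha_i>0$. Moreover, assume that $\underline{H}\succeq0$ and that $G$ is convex, twice differentiable and its Hessian matrix is bounded. Suppose the sequence $\{(u^k,p^k)\}$ is generated by VAPP-AL and the parameters satisfy $$0<\epsilon<\frac{\beta^{k}}{B_{G}+\gamma\,\lambda_{\max}(A^{\top}A)}\ \text{ for all }k\in\mathbb{N},\qquad 0<\rho<(1+\delta)\gamma,\ \text{ with some }0<\delta\le1 .$$ Then, for integers $t>0$, $\|u^{t}-u^{t+1}\|_{\overline{H}}^{2}=o(1/t)$ and $\|p^{t}-p^{t+1}\|^{2}=o(1/t)$.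
   Context: Problem (P): minimize $(G+J)(u)=G(u_1,\dots,u_N)+\sum_{i=1}^N J_i(u_i)$ subject to $Au=\sum_{i=1}^N A_iu_i=b$, $u_i\in U_i$ ($i=1,\dots,N$). Here $U_i\subset\mathbf{R}^{n_i}$ is convex, $U=U_1\times\cdots\times U_N\subset\mathbf{R}^n$, $n=\sum_i n_i$, $A=(A_1,\dots,A_N)\in\mathbf{R}^{m\times n}$ with $A_i\in\mathbf{R}^{m\times n_i}$, $b\in\mathbf{R}^m$, $J(u)=\sum_i J_i(u_i)$ with each $J_i$ convex on $U_i$ and possibly nonsmooth. Standing assumptions on (P): (i) $J$ is convex and lower semicontinuous (not necessarily differentiable) with $\mathrm{dom}\,J\cap U\ne\emptyset$; (ii) $G$ is convex and differentiable on $U$, with derivative Lipschitz of constant $B_G$ (so that, when $G$ is twice differentiable, $0\preceq\nabla^2G(u)\preceq B_GI$ for all $u\in U$); (iii) if $U$ is not bounded, $G+J$ is coercive on $U$: for every sequence $\{u^k\}\subset U$, $\|u^k\|\to+\infty$ implies $(G+J)(u^k)\to+\infty$; (iv) $0$ is in the interior of $A(U)-b$. For a core function $K^k$ (which may depend on the iteration $k$), $\beta^k$ denotes its strong convexity parameter, and $D_K^k(u,v)=K^k(u)-K^k(v)-\langle\nabla K^k(v),u-v\rangle$. VAPP-AL algorithm with parameters $\gamma,\epsilon,\rho>0$: choose $u^0\in U$, $p^0\in\mathbf{R}^m$; for $k=0,1,\dots$ let $u^{k+1}$ be the minimizer over $u\in U$ of $\langle\nabla G(u^k),u\rangle+J(u)+\langle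 p^k+\gamma(Au^k-b),Au\rangle+\frac1\epsilon D_K^k(u,u^k)$, and $p^{k+1}=p^k+\rho(Au^{k+1}-b)$. $P_i$ is a matrix with $n_i$ columns. $H$ is the block diagonal matrix $H=\frac1\epsilon\,\mathrm{diag}\big(\theta_1A_1^{\top}A_1+\alpha_1P_1^{\top}P_1,\dots,\theta_NA_N^{\top}A_N+\alpha_NP_N^{\top}P_N\big)$, and $\underline{H}=H-\gamma A^{\top}A-B_GI$, $\overline{H}=H-\gamma A^{\top}A$. For $Q\succeq0$, $\|x\|_Q=\sqrt{x^{\top}Qx}$. $\lambda_{\max}(\cdot)$ denotes the largest eigenvalue.
   Formalization: Assumption (iv) is taken as 0 in the interior of A(U ∩ dom J) − b; this is (iv) itself when J is finite on U, but if J may be +∞ inside U the claim with A(U) − b is false (U=R, G=0, J the indicator of {1}, A=1, b=0). *)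

theory Defs
  imports "HOL-Analysis.Analysis" "HOL-Library.Landau_Symbols"
begin

section \<open>Block structure\<close>

text \<open>
  The product of the spaces R^{n_i}, i = 1..N, is \<^typ>\<open>real^'n\<close> together with a map
  c :: 'n => 'b that sends each of the n coordinates to the index of its block; the
  blocks are indexed by the finite type 'b (so N = CARD('b)) and n_i is the
  number of coordinates with label i. The space R^{n_i} is represented by the coordinate
  subspace of the i-th block, with zeros in all other coordinates; accordingly, a matrix with
  n_i columns is represented by one with n columns whose columns outside block i vanish.
\<close>

definition blk_dim :: "('n::finite \<Rightarrow> 'b) \<Rightarrow> 'b \<Rightarrow> nat" where
  "blk_dim c i = card {j. c j = i}"

definition blk_space :: "('n::finite \<Rightarrow> 'b) \<Rightarrow> 'b \<Rightarrow> (real^'n) set" where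
  "blk_space c i = {x. \<forall>j. c j \<noteq> i \<longrightarrow> x $ j = 0}"

definition blk :: "('n::finite \<Rightarrow> 'b) \<Rightarrow> 'b \<Rightarrow> real^'n \<Rightarrow> real^'n" where
  "blk c i u = (\<chi> j. if c j = i then u $ j else 0)"

definition col_blk :: "('n::finite \<Rightarrow> 'b) \<Rightarrow> 'b \<Rightarrow> real^'n^'r \<Rightarrow> real^'n^'r" where
  "col_blk c i M = (\<chi> r j. if c j = i then M $ r $ j else 0)"

text \<open>Zero columns do not change the rank, so this is full column rank of the
  matrix formed by the n_i columns in block i.\<close>

definition full_col_rank_blk :: "('n::finite \<Rightarrow> 'b) \<Rightarrow> 'b \<Rightarrow> real^'n^('r::finite) \<Rightarrow> bool" where
  "full_col_rank_blk c i M \<longleftrightarrow> rank (col_blk c i M) = blk_dim c i"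

definition block_diag :: "('n::finite \<Rightarrow> 'b) \<Rightarrow> ('b \<Rightarrow> real^'n^'n) \<Rightarrow> real^'n^'n" where
  "block_diag c B = (\<chi> j l. if c j = c l then B (c j) $ j $ l else 0)"

definition prod_set :: "('n::finite \<Rightarrow> 'b) \<Rightarrow> ('b \<Rightarrow> (real^'n) set) \<Rightarrow> (real^'n) set" where
  "prod_set c Us = {u. \<forall>i. blk c i u \<in> Us i}"

definition sep_sum :: "('n::finite \<Rightarrow> 'b::finite) \<Rightarrow> ('b \<Rightarrow> real^'n \<Rightarrow> ereal) \<Rightarrow> real^'n \<Rightarrow> ereal" where
  "sep_sum c Js u = (\<Sum>i\<in>UNIV. Js i (blk c i u))"


section \<open>Convex analysis\<close>

definition ext_dom :: "('a \<Rightarrow> ereal) \<Rightarrow> 'a set" where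
  "ext_dom f = {x. f x < \<infinity>}"

text \<open>Meant for functions that do not take the value \<open>-\<infinity>\<close> on \<open>S\<close>.\<close>

definition ext_convex_on :: "'a::real_vector set \<Rightarrow> ('a \<Rightarrow> ereal) \<Rightarrow> bool" where
  "ext_convex_on S f \<longleftrightarrow> convex S \<and>
    (\<forall>x\<in>S. \<forall>y\<in>S. \<forall>a\<ge>0. \<forall>b\<ge>0. a + b = 1 \<longrightarrow>
       f (a *\<^sub>R x + b *\<^sub>R y) \<le> ereal a * f x + ereal b * f y)"

definition lsc_on :: "'a::topological_space set \<Rightarrow> ('a \<Rightarrow> ereal) \<Rightarrow> bool" where
  "lsc_on S f \<longleftrightarrow> (\<forall>x\<in>S. f x \<le> Liminf (at x within S) f)"

definition strongly_convex_on :: "'a::real_normed_vector set \<Rightarrow> real \<Rightarrow> ('a \<Rightarrow> real) \<Rightarrow> bool" where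
  "strongly_convex_on S \<beta> f \<longleftrightarrow> convex S \<and>
    (\<forall>x\<in>S. \<forall>y\<in>S. \<forall>a\<ge>0. \<forall>b\<ge>0. a + b = 1 \<longrightarrow>
       f (a *\<^sub>R x + b *\<^sub>R y) \<le> a * f x + b * f y - \<beta> / 2 * a * b * (norm (x - y))\<^sup>2)"

definition gradient :: "('a::real_inner \<Rightarrow> real) \<Rightarrow> 'a \<Rightarrow> 'a" where
  "gradient f x = (THE D. GDERIV f x :> D)"

definition twice_differentiable_at :: "(real^('n::finite) \<Rightarrow> real) \<Rightarrow> real^'n \<Rightarrow> bool" where
  "twice_differentiable_at f x \<longleftrightarrow>
     (\<forall>\<^sub>F y in nhds x. f differentiable (at y)) \<and> gradient f differentiable (at x)"

definition hessian :: "(real^('n::finite) \<Rightarrow> real) \<Rightarrow> real^'n \<Rightarrow> real^'n^'n" where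
  "hessian f x = jacobian (gradient f) (at x)"

definition bregman :: "('a::real_inner \<Rightarrow> real) \<Rightarrow> 'a \<Rightarrow> 'a \<Rightarrow> real" where
  "bregman K u v = K u - K v - gradient K v \<bullet> (u - v)"

definition psd :: "real^'n^('n::finite) \<Rightarrow> bool" where
  "psd Q \<longleftrightarrow> transpose Q = Q \<and> (\<forall>x. 0 \<le> x \<bullet> (Q *v x))"

definition qnorm :: "real^'n^('n::finite) \<Rightarrow> real^'n \<Rightarrow> real" where
  "qnorm Q x = sqrt (x \<bullet> (Q *v x))"

text \<open>Only used for symmetric matrices, whose set of real eigenvalues is finite and nonempty.\<close>

definition lambda_max :: "real^'n^('n::finite) \<Rightarrow> real" where
  "lambda_max M = Max {l. \<exists>v. v \<noteq> 0 \<and> M *v v = l *\<^sub>R v}"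


section \<open>The algorithm\<close>

text \<open>The core function K^k; the argument \<open>v\<close> is the iterate u^k.\<close>

definition core_fun ::
  "('n::finite \<Rightarrow> 'b::finite) \<Rightarrow> real^'n^('m::finite) \<Rightarrow> real^'m \<Rightarrow> ('b \<Rightarrow> real^'n^('q::finite)) \<Rightarrow>
   ('b \<Rightarrow> real) \<Rightarrow> ('b \<Rightarrow> real) \<Rightarrow> real^'n \<Rightarrow> real^'n \<Rightarrow> real" where
  "core_fun c A b P \<theta> \<alpha> v u =
     (\<Sum>i\<in>UNIV. \<theta> i / 2 *
        (norm (col_blk c i A *v blk c i u
             + ((\<Sum>j\<in>UNIV - {i}. col_blk c j A *v blk c j v) - b)))\<^sup>2)
   + (\<Sum>i\<in>UNIV. \<alpha> i / 2 * (norm (col_blk c i (P i) *v blk c i u))\<^sup>2)"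

definition H_mat ::
  "('n::finite \<Rightarrow> 'b::finite) \<Rightarrow> real^'n^('m::finite) \<Rightarrow> ('b \<Rightarrow> real^'n^('q::finite)) \<Rightarrow>
   ('b \<Rightarrow> real) \<Rightarrow> ('b \<Rightarrow> real) \<Rightarrow> real \<Rightarrow> real^'n^'n" where
  "H_mat c A P \<theta> \<alpha> \<epsilon> = (1 / \<epsilon>) *\<^sub>R block_diag c (\<lambda>i.
       \<theta> i *\<^sub>R (transpose (col_blk c i A) ** col_blk c i A)
     + \<alpha> i *\<^sub>R (transpose (col_blk c i (P i)) ** col_blk c i (P i)))"

definition H_upper :: "real^'n^('n::finite) \<Rightarrow> real^'n^('m::finite) \<Rightarrow> real \<Rightarrow> real^'n^'n" where
  "H_upper H A \<gamma> = H - \<gamma> *\<^sub>R (transpose A ** A)"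

definition H_lower :: "real^'n^('n::finite) \<Rightarrow> real^'n^('m::finite) \<Rightarrow> real \<Rightarrow> real \<Rightarrow> real^'n^'n" where
  "H_lower H A \<gamma> BG = H - \<gamma> *\<^sub>R (transpose A ** A) - BG *\<^sub>R mat 1"

definition vapp_al ::
  "(real^'n \<Rightarrow> real) \<Rightarrow> (real^'n \<Rightarrow> ereal) \<Rightarrow> real^'n^('m::finite) \<Rightarrow> real^'m \<Rightarrow> (real^'n) set \<Rightarrow>
   (nat \<Rightarrow> real^('n::finite) \<Rightarrow> real) \<Rightarrow> real \<Rightarrow> real \<Rightarrow> real \<Rightarrow>
   (nat \<Rightarrow> real^'n) \<Rightarrow> (nat \<Rightarrow> real^'m) \<Rightarrow> bool" where
  "vapp_al G J A b U K \<gamma> \<epsilon> \<rho> u p \<longleftrightarrow>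
     u 0 \<in> U \<and>
     (\<forall>k. is_arg_min
            (\<lambda>v. ereal (gradient G (u k) \<bullet> v) + J v
                 + ereal ((p k + \<gamma> *\<^sub>R (A *v u k - b)) \<bullet> (A *v v)
                          + 1 / \<epsilon> * bregman (K k) v (u k)))
            (\<lambda>v. v \<in> U) (u (Suc k))) \<and>
     (\<forall>k. p (Suc k) = p k + \<rho> *\<^sub>R (A *v u (Suc k) - b))"

end

theory Submission
  imports Defs
begin

text \<open>Write \<open>r k = A u\<^sub>k - b\<close>, \<open>d k = u\<^sub>k\<^sub>+\<^sub>1 - u\<^sub>k\<close>, and \<open>Q\<close> for the matrix \<open>H_upper\<close>. The core function
is a quadratic with Hessian \<open>\<epsilon> H\<close>, so its Bregman distance divided by \<open>\<epsilon>\<close> is half the squared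
\<open>H\<close>-seminorm. Replacing \<open>\<gamma> r k\<close> by \<open>\<gamma> r (k+1)\<close> in the optimality condition of step \<open>k\<close> turns
\<open>H\<close> into \<open>Q\<close>. The algorithm is thus a proximal augmented Lagrangian method with proximal metric
\<open>Q\<close> in which \<open>G\<close> is linearized, and \<open>H_lower\<close> being positive semidefinite says that the metric
dominates the curvature of \<open>G\<close>.

Both rates follow from one fact: the energy
\<open>E k = \<rho>/2 \<parallel>r (k+1)\<parallel>\<^sup>2 + 1/2 \<parallel>d k\<parallel>\<^sup>2\<close>, the last norm taken in \<open>Q\<close>, is nonincreasing and summable,
and such a sequence is \<open>o(1/k)\<close>. Up to constants it dominates both quantities of interest, because
the multipliers move by \<open>\<rho> r (k+1)\<close>.

Summability (\<open>summable_gain\<close>). By Slater's condition there is a multiplier \<open>l\<close>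
(\<open>lagrange_multiplier_exists\<close>). For feasible \<open>v\<close> the function
\<open>1/2 \<parallel>u\<^sub>k - v\<parallel>\<^sup>2 + 1/(2\<rho>) \<parallel>p\<^sub>k - l\<parallel>\<^sup>2\<close>, the first norm taken in \<open>Q\<close>, decreases in each step by at
least \<open>(\<gamma> - \<rho>/2) \<parallel>r (k+1)\<parallel>\<^sup>2 + \<kappa>/2 \<parallel>d k\<parallel>\<^sup>2\<close>, up to the amount by which \<open>v\<close> fails to be optimal.
The coefficient \<open>\<gamma> - \<rho>/2\<close> is positive since \<open>\<rho> < 2 \<gamma>\<close>; the positive constant \<open>\<kappa>\<close> comes from the
strict bound on \<open>\<epsilon>\<close> and the strong convexity of the core function. The set \<open>U\<close> may fail to be
closed, so there may be no optimal \<open>v\<close>. For the sum of the first \<open>T\<close> decreases a feasible point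
with optimality gap below \<open>1/(T+1)\<close> serves instead: it changes the bound by at most one, and all
these points lie in a common bounded sublevel set.

Monotonicity (\<open>residual_energy_antimono\<close>). Test each of two consecutive optimality conditions
with the minimizer of the other one and add. Everything is then a telescoping square, apart from
the inner product of the gradient difference \<open>\<nabla>G(u\<^sub>k\<^sub>+\<^sub>1) - \<nabla>G(u\<^sub>k)\<close> with \<open>d (k+1)\<close>. By the mean
value theorem this is \<open>\<langle>M d k, d (k+1)\<rangle>\<close> for a Hessian \<open>M\<close> of \<open>G\<close>. Since \<open>M\<close> is symmetric, and
lies between \<open>0\<close> and \<open>BG\<close> in the directions that occur, polarization bounds it below by
\<open>- BG/2 \<parallel>d (k+1) - d k\<parallel>\<^sup>2\<close> (\<open>gradient_three_point_lower_bound\<close>), which the metric \<open>Q\<close> absorbs.\<close>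

section \<open>Differentiable convex functions with Lipschitz gradient\<close>

lemma gradient_eqI:
  assumes "GDERIV f x :> D"
  shows "gradient f x = D"
proof -
  have "E = D" if "GDERIV f x :> E" for E
  proof -
    have "(\<lambda>h. h \<bullet> E) = (\<lambda>h. h \<bullet> D)"
      using that assms unfolding gderiv_def by (rule has_derivative_unique)
    then have "(E - D) \<bullet> E = (E - D) \<bullet> D" by (rule fun_cong)
    then have "(E - D) \<bullet> (E - D) = 0" by (simp add: inner_diff_right)
    then show ?thesis by simp
  qed
  then show ?thesis
    unfolding gradient_def using assms by blast
qed

lemma has_derivative_gradient:
  fixes f :: "'a::euclidean_space \<Rightarrow> real"
  assumes "f differentiable (at x)"
  shows "(f has_derivative (\<lambda>h. gradient f x \<bullet> h)) (at x)"
proof -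
  obtain L where L: "(f has_derivative L) (at x)"
    using assms unfolding differentiable_def by blast
  then have lin: "linear L" by (rule has_derivative_linear)
  have "L = (\<lambda>h. h \<bullet> adjoint L 1)"
    using adjoint_works[OF lin, of _ "1::real"] by simp
  with L have G: "GDERIV f x :> adjoint L 1"
    unfolding gderiv_def by simp
  show ?thesis
    unfolding gradient_eqI[OF G] using G by (simp add: gderiv_def inner_commute)
qed

lemma has_real_derivative_along_line:
  fixes f :: "'a::euclidean_space \<Rightarrow> real"
  assumes "f differentiable (at (x + t *\<^sub>R d))"
  shows "((\<lambda>s. f (x + s *\<^sub>R d)) has_real_derivative gradient f (x + t *\<^sub>R d) \<bullet> d) (at t within T)"
proof -
  have "((\<lambda>s. x + s *\<^sub>R d) has_derivative (\<lambda>s. s *\<^sub>R d)) (at t within T)"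
    by (auto intro!: derivative_eq_intros)
  from has_derivative_compose[OF this has_derivative_gradient[OF assms]]
  have "((\<lambda>s. f (x + s *\<^sub>R d)) has_derivative (\<lambda>s. gradient f (x + t *\<^sub>R d) \<bullet> (s *\<^sub>R d))) (at t within T)" .
  moreover have "(\<lambda>s. gradient f (x + t *\<^sub>R d) \<bullet> (s *\<^sub>R d)) = (*) (gradient f (x + t *\<^sub>R d) \<bullet> d)"
    by (rule ext) simp
  ultimately show ?thesis unfolding has_field_derivative_def by simp
qed

lemma convex_line_mem:
  assumes "convex S" "x \<in> S" "x + d \<in> S" "0 \<le> t" "t \<le> 1"
  shows "x + t *\<^sub>R d \<in> S"
  using convexD_alt[OF assms] by (simp add: algebra_simps)

text \<open>Only a limit along the segment from \<open>x\<close> to \<open>y\<close> enters, so \<open>x\<close> may lie on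
the boundary of \<open>S\<close> and \<open>S\<close> may have empty interior.\<close>
lemma convex_on_above_gradient:
  fixes f :: "'a::euclidean_space \<Rightarrow> real"
  assumes cvx: "convex_on S f" and S: "x \<in> S" "y \<in> S" and diff: "f differentiable (at x)"
  shows "f x + gradient f x \<bullet> (y - x) \<le> f y"
proof -
  let ?d = "y - x"
  have "((\<lambda>s. f (x + s *\<^sub>R ?d)) has_real_derivative gradient f x \<bullet> ?d) (at 0)"
    using has_real_derivative_along_line[of f x 0 ?d] diff by simp
  then have "((\<lambda>t. (f (x + t *\<^sub>R ?d) - f x) / t) \<longlongrightarrow> gradient f x \<bullet> ?d) (at_right 0)"
    by (auto simp: has_field_derivative_iff intro: filterlim_at_split[THEN iffD1, THEN conjunct2])
  moreover have "\<forall>\<^sub>F t in at_right 0. (f (x + t *\<^sub>R ?d) - f x) / t \<le> f y - f x"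
    unfolding eventually_at_right_field
  proof (intro exI[of _ 1] conjI allI impI)
    fix t :: real assume t: "0 < t" "t < 1"
    have "f (x + t *\<^sub>R ?d) = f ((1 - t) *\<^sub>R x + t *\<^sub>R y)" by (simp add: algebra_simps)
    also have "\<dots> \<le> (1 - t) * f x + t * f y"
      using cvx S t unfolding convex_on_def by simp
    finally show "(f (x + t *\<^sub>R ?d) - f x) / t \<le> f y - f x"
      using t by (simp add: divide_simps algebra_simps)
  qed simp
  ultimately have "gradient f x \<bullet> ?d \<le> f y - f x"
    by (rule tendsto_upperbound) simp
  then show ?thesis by simp
qed

text \<open>The descent lemma: along the segment, the function minus its linear part minus
the quadratic \<open>B/2 t\<^sup>2 \<parallel>y - x\<parallel>\<^sup>2\<close> has nonpositive derivative.\<close>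
lemma lipschitz_gradient_upper_bound:
  fixes f :: "'a::euclidean_space \<Rightarrow> real"
  assumes "convex S" and diff: "\<And>x. x \<in> S \<Longrightarrow> f differentiable (at x)"
    and lip: "B-lipschitz_on S (gradient f)" and S: "x \<in> S" "y \<in> S"
  shows "f y \<le> f x + gradient f x \<bullet> (y - x) + B / 2 * (norm (y - x))\<^sup>2"
proof -
  let ?d = "y - x"
  let ?\<phi> = "\<lambda>t. f (x + t *\<^sub>R ?d) - t * (gradient f x \<bullet> ?d) - B / 2 * t\<^sup>2 * (norm ?d)\<^sup>2"
  have "\<exists>l. (?\<phi> has_real_derivative l) (at t) \<and> l \<le> 0" if t: "0 \<le> t" "t \<le> 1" for t
  proof -
    let ?w = "x + t *\<^sub>R ?d"
    have w: "?w \<in> S" by (rule convex_line_mem) (use assms t in auto)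
    note line = has_real_derivative_along_line[OF diff[OF w]]
    have "(?\<phi> has_real_derivative
            (gradient f ?w \<bullet> ?d - gradient f x \<bullet> ?d - B * t * (norm ?d)\<^sup>2)) (at t)"
      by (rule derivative_eq_intros line refl)+ simp
    moreover have "gradient f ?w \<bullet> ?d - gradient f x \<bullet> ?d \<le> B * t * (norm ?d)\<^sup>2"
    proof -
      have "(gradient f ?w - gradient f x) \<bullet> ?d \<le> norm (gradient f ?w - gradient f x) * norm ?d"
        by (rule norm_cauchy_schwarz)
      also have "\<dots> \<le> (B * norm (?w - x)) * norm ?d"
        using lipschitz_onD[OF lip w S(1)] by (intro mult_right_mono) (auto simp: dist_norm)
      finally show ?thesis using t by (simp add: inner_diff_left power2_eq_square)
    qed
    ultimately show ?thesis by (intro exI conjI) auto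
  qed
  then have "?\<phi> 1 \<le> ?\<phi> 0"
    by (intro DERIV_nonpos_imp_nonincreasing[of 0 1 ?\<phi>]) auto
  then show ?thesis by simp
qed

section \<open>Second derivatives of convex functions\<close>

text \<open>The mixed second difference in the directions \<open>d\<close> and \<open>e\<close> is computed by one mean value
theorem in direction \<open>d\<close> and then by the first-order expansion of the gradient at \<open>w\<close>. The second
difference is symmetric in \<open>d\<close> and \<open>e\<close>, whereas the right-hand side is not; this is how symmetry
of the second derivative arises.\<close>
lemma second_difference_bound:
  fixes f :: "'a::euclidean_space \<Rightarrow> real"
  assumes M: "linear M"
    and diff: "\<And>y. norm (y - w) < r \<Longrightarrow> f differentiable (at y)"
    and err: "\<And>y. norm (y - w) < r \<Longrightarrow>
        norm (gradient f y - gradient f w - M (y - w)) \<le> \<eta> * norm (y - w)"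
    and h: "0 < h" "h * (norm d + norm e) < r" and \<eta>: "0 \<le> \<eta>"
  shows "\<bar>f (w + h *\<^sub>R d + h *\<^sub>R e) - f (w + h *\<^sub>R d) - f (w + h *\<^sub>R e) + f w - h\<^sup>2 * (M e \<bullet> d)\<bar>
         \<le> h\<^sup>2 * (2 * \<eta> * (norm d + norm e)\<^sup>2)"
proof -
  let ?\<phi> = "\<lambda>s. f (w + h *\<^sub>R e + s *\<^sub>R d) - f (w + s *\<^sub>R d)"
  let ?a = "\<lambda>s. w + h *\<^sub>R e + s *\<^sub>R d" and ?b = "\<lambda>s. w + s *\<^sub>R d"
  let ?n = "norm d + norm e"
  have near: "norm (?a s - w) \<le> h * ?n" "norm (?b s - w) \<le> h * ?n" if "0 \<le> s" "s \<le> h" for s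
  proof -
    have "norm (h *\<^sub>R e + s *\<^sub>R d) \<le> h * norm e + s * norm d"
      using norm_triangle_ineq[of "h *\<^sub>R e" "s *\<^sub>R d"] that h by simp
    also have "\<dots> \<le> h * ?n" using that by (simp add: algebra_simps mult_right_mono)
    finally show "norm (?a s - w) \<le> h * ?n" by (simp add: add.assoc)
    have "s * norm d \<le> h * norm d" "0 \<le> h * norm e" using that h by (auto intro: mult_right_mono)
    then have "s * norm d \<le> h * ?n" unfolding distrib_left by linarith
    then show "norm (?b s - w) \<le> h * ?n" using that by simp
  qed
  have der: "(?\<phi> has_real_derivative (gradient f (?a s) \<bullet> d - gradient f (?b s) \<bullet> d)) (at s)"
    if "0 \<le> s" "s \<le> h" for s
    using near[OF that] h
    by (intro DERIV_diff has_real_derivative_along_line diff) auto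
  obtain s where s: "0 < s" "s < h"
    and mvt: "?\<phi> h - ?\<phi> 0 = (h - 0) * (gradient f (?a s) \<bullet> d - gradient f (?b s) \<bullet> d)"
    using MVT2[OF h(1) der] by blast
  define E where "E = gradient f (?a s) - gradient f (?b s) - M (h *\<^sub>R e)"
  have "E = (gradient f (?a s) - gradient f w - M (?a s - w))
           - (gradient f (?b s) - gradient f w - M (?b s - w))"
    unfolding E_def by (simp add: linear_add[OF M] linear_diff[OF M])
  also have "norm \<dots> \<le> \<eta> * norm (?a s - w) + \<eta> * norm (?b s - w)"
    using near[of s] s h by (intro order_trans[OF norm_triangle_ineq4] add_mono err) auto
  also have "\<dots> \<le> \<eta> * (h * ?n) + \<eta> * (h * ?n)"
    using near[of s] s \<eta> by (intro add_mono mult_left_mono) auto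
  finally have E: "norm E \<le> 2 * \<eta> * h * ?n" by simp
  have "f (w + h *\<^sub>R d + h *\<^sub>R e) - f (w + h *\<^sub>R d) - f (w + h *\<^sub>R e) + f w - h\<^sup>2 * (M e \<bullet> d)
        = h * (E \<bullet> d)"
    using mvt by (simp add: E_def linear_scale[OF M] inner_diff_left algebra_simps power2_eq_square)
  moreover have "\<bar>h * (E \<bullet> d)\<bar> \<le> h * (norm E * norm d)"
    using Cauchy_Schwarz_ineq2[of E d] h by (simp add: abs_mult)
  moreover have "h * (norm E * norm d) \<le> h * ((2 * \<eta> * h * ?n) * ?n)"
    using E h \<eta> by (intro mult_left_mono mult_mono) auto
  ultimately show ?thesis by (simp add: power2_eq_square algebra_simps)
qed

text \<open>Both \<open>M e \<bullet> d\<close> and \<open>M d \<bullet> e\<close> approximate the same mixed second difference divided by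
\<open>h\<^sup>2\<close>, with an error that is an arbitrarily small multiple \<open>\<eta>\<close> of a constant. Differentiability of
the gradient at the single point \<open>w\<close> yields this.\<close>
lemma second_derivative_symmetric:
  fixes f :: "'a::euclidean_space \<Rightarrow> real"
  assumes ev: "\<forall>\<^sub>F y in nhds w. f differentiable (at y)"
    and M: "(gradient f has_derivative M) (at w)"
  shows "M e \<bullet> d = M d \<bullet> e"
proof -
  have lin: "linear M" using M by (rule has_derivative_linear)
  let ?n = "norm d + norm e"
  have bound: "\<bar>M e \<bullet> d - M d \<bullet> e\<bar> \<le> \<eta> * (4 * ?n\<^sup>2)" if \<eta>: "\<eta> > 0" for \<eta>
  proof -
    obtain r1 where r1: "r1 > 0" "\<And>y. norm (y - w) < r1 \<Longrightarrow> f differentiable (at y)"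
      using ev by (auto simp: eventually_nhds_metric dist_norm)
    obtain r2 where r2: "r2 > 0" "\<And>y. norm (y - w) < r2 \<Longrightarrow>
        norm (gradient f y - gradient f w - M (y - w)) \<le> \<eta> * norm (y - w)"
      using M \<eta> unfolding has_derivative_at_alt by blast
    define r where "r = min r1 r2"
    define c where "c = ?n + 1"
    define h where "h = r / c"
    have c: "c > 0" unfolding c_def by (intro add_nonneg_pos) auto
    have r: "r > 0" using r1 r2 by (simp add: r_def)
    have h: "h > 0" using r c by (simp add: h_def)
    have "h * c = r" using c by (simp add: h_def)
    then have "h * ?n + h = r" by (simp add: c_def distrib_left)
    then have hr: "h * ?n < r" using h by linarith
    then have hr': "h * (norm e + norm d) < r" by (simp add: add.commute)
    have "\<bar>f (w + h *\<^sub>R d + h *\<^sub>R e) - f (w + h *\<^sub>R d) - f (w + h *\<^sub>R e) + f w - h\<^sup>2 * (M e \<bullet> d)\<bar>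
         \<le> h\<^sup>2 * (2 * \<eta> * (norm d + norm e)\<^sup>2)"
      by (rule second_difference_bound[OF lin _ _ h hr]) (use r1 r2 \<eta> in \<open>auto simp: r_def\<close>)
    moreover have "\<bar>f (w + h *\<^sub>R e + h *\<^sub>R d) - f (w + h *\<^sub>R e) - f (w + h *\<^sub>R d) + f w - h\<^sup>2 * (M d \<bullet> e)\<bar>
         \<le> h\<^sup>2 * (2 * \<eta> * (norm e + norm d)\<^sup>2)"
      by (rule second_difference_bound[OF lin _ _ h hr']) (use r1 r2 \<eta> in \<open>auto simp: r_def\<close>)
    ultimately have "\<bar>h\<^sup>2 * (M e \<bullet> d) - h\<^sup>2 * (M d \<bullet> e)\<bar> \<le> h\<^sup>2 * (\<eta> * (4 * ?n\<^sup>2))"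
      by (simp add: add.commute add.left_commute)
    then have "h\<^sup>2 * \<bar>M e \<bullet> d - M d \<bullet> e\<bar> \<le> h\<^sup>2 * (\<eta> * (4 * ?n\<^sup>2))"
      by (simp add: right_diff_distrib[symmetric] abs_mult)
    then show ?thesis using h by (simp add: mult_le_cancel_left_pos)
  qed
  have "\<bar>M e \<bullet> d - M d \<bullet> e\<bar> \<le> 0"
  proof (rule field_le_epsilon)
    fix t :: real assume t: "t > 0"
    have "t / (4 * ?n\<^sup>2 + 1) > 0" using t by (intro divide_pos_pos) (auto intro: add_nonneg_pos)
    from bound[OF this] have "\<bar>M e \<bullet> d - M d \<bullet> e\<bar> \<le> t / (4 * ?n\<^sup>2 + 1) * (4 * ?n\<^sup>2)" .
    also have "t / (N + 1) * N \<le> t" if "N \<ge> 0" for N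
      using t that by (simp add: field_simps)
    then have "t / (4 * ?n\<^sup>2 + 1) * (4 * ?n\<^sup>2) \<le> t" by simp
    finally show "\<bar>M e \<bullet> d - M d \<bullet> e\<bar> \<le> 0 + t" by simp
  qed
  then show ?thesis by simp
qed

text \<open>When \<open>S\<close> has empty interior, convexity and the Lipschitz bound on \<open>S\<close> say nothing about
the second derivative in directions that leave the affine hull of \<open>S\<close>. Hence the restriction to
directions along which one can move inside \<open>S\<close>.\<close>
lemma second_derivative_bounds_feasible_direction:
  fixes f :: "'a::euclidean_space \<Rightarrow> real"
  assumes cvx: "convex_on S f" and diff: "\<And>x. x \<in> S \<Longrightarrow> f differentiable (at x)"
    and lip: "B-lipschitz_on S (gradient f)"
    and M: "(gradient f has_derivative M) (at w)"
    and w: "w \<in> S" and feas: "\<forall>\<^sub>F t in at_right 0. w + t *\<^sub>R e \<in> S"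
  shows "0 \<le> M e \<bullet> e" and "M e \<bullet> e \<le> B * (norm e)\<^sup>2"
proof -
  have "((\<lambda>s. w + s *\<^sub>R e) has_derivative (\<lambda>s. s *\<^sub>R e)) (at 0)"
    by (auto intro!: derivative_eq_intros)
  moreover have "(gradient f has_derivative M) (at (w + 0 *\<^sub>R e))" using M by simp
  ultimately have "((\<lambda>s. gradient f (w + s *\<^sub>R e)) has_derivative (\<lambda>s. M (s *\<^sub>R e))) (at 0)"
    by (rule has_derivative_compose)
  then have "((\<lambda>s. gradient f (w + s *\<^sub>R e)) has_vector_derivative M e) (at 0)"
    using linear_scale[OF has_derivative_linear[OF M]] by (simp add: has_vector_derivative_def)
  then have "((\<lambda>s. gradient f (w + s *\<^sub>R e) \<bullet> e) has_real_derivative M e \<bullet> e) (at 0)"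
    unfolding has_vector_derivative_def has_field_derivative_def
    by (auto intro!: derivative_eq_intros simp: mult.commute)
  then have lim: "((\<lambda>t. (gradient f (w + t *\<^sub>R e) \<bullet> e - gradient f w \<bullet> e) / t) \<longlongrightarrow> M e \<bullet> e) (at_right 0)"
    by (auto simp: has_field_derivative_iff intro: filterlim_at_split[THEN iffD1, THEN conjunct2])
  have pos: "\<forall>\<^sub>F t in at_right (0::real). 0 < t"
    by (simp add: eventually_at_right_less)
  have "\<forall>\<^sub>F t in at_right 0. 0 \<le> (gradient f (w + t *\<^sub>R e) \<bullet> e - gradient f w \<bullet> e) / t"
    using feas pos
  proof eventually_elim
    case (elim t)
    have "f w + gradient f w \<bullet> (t *\<^sub>R e) \<le> f (w + t *\<^sub>R e)"
      using convex_on_above_gradient[OF cvx w elim(1) diff[OF w]] by simp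
    moreover have "f (w + t *\<^sub>R e) - gradient f (w + t *\<^sub>R e) \<bullet> (t *\<^sub>R e) \<le> f w"
      using convex_on_above_gradient[OF cvx elim(1) w diff[OF elim(1)]] by simp
    ultimately have "t * (gradient f w \<bullet> e) \<le> t * (gradient f (w + t *\<^sub>R e) \<bullet> e)" by simp
    then show ?case using elim(2) by simp
  qed
  with lim show "0 \<le> M e \<bullet> e" by (rule tendsto_lowerbound) simp
  have "\<forall>\<^sub>F t in at_right 0. (gradient f (w + t *\<^sub>R e) \<bullet> e - gradient f w \<bullet> e) / t \<le> B * (norm e)\<^sup>2"
    using feas pos
  proof eventually_elim
    case (elim t)
    have "(gradient f (w + t *\<^sub>R e) - gradient f w) \<bullet> e
          \<le> norm (gradient f (w + t *\<^sub>R e) - gradient f w) * norm e" by (rule norm_cauchy_schwarz)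
    also have "\<dots> \<le> (B * norm (t *\<^sub>R e)) * norm e"
      using lipschitz_onD[OF lip elim(1) w] by (intro mult_right_mono) (auto simp: dist_norm)
    finally show ?case using elim(2) by (simp add: inner_diff_left power2_eq_square divide_simps algebra_simps)
  qed
  with lim show "M e \<bullet> e \<le> B * (norm e)\<^sup>2" by (rule tendsto_upperbound) simp
qed

text \<open>For \<open>d = y - x\<close>, \<open>e = z - y\<close> and a Hessian \<open>M\<close> between \<open>x\<close> and \<open>y\<close>, the right-hand side is
\<open>\<langle>M d, e\<rangle> = 1/2 (\<langle>M d, d\<rangle> + \<langle>M e, e\<rangle> - \<langle>M (e - d), e - d\<rangle>)\<close>. The mean value theorem places the base
point of \<open>M\<close> strictly between \<open>x\<close> and \<open>y\<close>. From there \<open>d\<close>, \<open>e\<close> and \<open>e - d\<close> all point into the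
triangle \<open>x, y, z\<close>, so the bounds for feasible directions apply to the three terms.\<close>
lemma gradient_three_point_lower_bound:
  fixes f :: "real^'n::finite \<Rightarrow> real"
  assumes cvx: "convex_on S f" and twice: "\<And>x. x \<in> S \<Longrightarrow> twice_differentiable_at f x"
    and lip: "B-lipschitz_on S (gradient f)"
    and S: "x \<in> S" "y \<in> S" "z \<in> S"
  shows "- (B / 2) * (norm ((z - y) - (y - x)))\<^sup>2 \<le> (gradient f y - gradient f x) \<bullet> (z - y)"
proof -
  have diff: "\<And>x. x \<in> S \<Longrightarrow> f differentiable (at x)"
    using twice unfolding twice_differentiable_at_def by (auto dest: eventually_nhds_x_imp_x)
  have convS: "convex S" using cvx by (simp add: convex_on_def)
  define d e where "d = y - x" and "e = z - y"
  define D where "D v = frechet_derivative (gradient f) (at v)" for v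
  have D: "(gradient f has_derivative D v) (at v)" if "v \<in> S" for v
    using twice[OF that] unfolding twice_differentiable_at_def D_def
    by (simp add: frechet_derivative_works)
  let ?\<phi> = "\<lambda>s. gradient f (x + s *\<^sub>R d) \<bullet> e"
  have seg: "x + s *\<^sub>R d \<in> S" if "0 \<le> s" "s \<le> 1" for s
    by (rule convex_line_mem) (use that convS S in \<open>auto simp: d_def\<close>)
  have der: "(?\<phi> has_real_derivative D (x + s *\<^sub>R d) d \<bullet> e) (at s)" if "0 \<le> s" "s \<le> 1" for s
  proof -
    have "((\<lambda>s. x + s *\<^sub>R d) has_derivative (\<lambda>s. s *\<^sub>R d)) (at s)"
      by (auto intro!: derivative_eq_intros)
    from has_derivative_compose[OF this D[OF seg[OF that]]]
    have "((\<lambda>s. gradient f (x + s *\<^sub>R d)) has_derivative (\<lambda>t. t *\<^sub>R D (x + s *\<^sub>R d) d)) (at s)"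
      using linear_scale[OF has_derivative_linear[OF D[OF seg[OF that]]]] by simp
    then show ?thesis unfolding has_field_derivative_def
      by (auto intro!: derivative_eq_intros simp: mult.commute)
  qed
  obtain s where s: "0 < s" "s < 1" and mvt: "?\<phi> 1 - ?\<phi> 0 = (1 - 0) * (D (x + s *\<^sub>R d) d \<bullet> e)"
    using MVT2[of 0 1 ?\<phi>, OF _ der] by auto
  define w where "w = x + s *\<^sub>R d"
  have w: "w \<in> S" using seg s by (simp add: w_def)
  have lin: "linear (D w)" using D[OF w] by (rule has_derivative_linear)
  have feas: "\<forall>\<^sub>F t in at_right 0. w + t *\<^sub>R (a *\<^sub>R d + c *\<^sub>R e) \<in> S"
    if ac: "0 \<le> c" "\<bar>a\<bar> \<le> 1" "c \<le> 1" for a c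
    unfolding eventually_at_right_field
  \<comment> \<open>For such \<open>t\<close> the barycentric coordinates \<open>1 - s - t a\<close>, \<open>s + t a - t c\<close>, \<open>t c\<close> are nonnegative.\<close>
  proof (intro exI[of _ "min (s / 2) (1 - s)"] conjI allI impI)
    fix t assume t: "0 < t" "t < min (s / 2) (1 - s)"
    have ta: "\<bar>t * a\<bar> \<le> t" and tc: "0 \<le> t * c" "t * c \<le> t"
      using t ac by (auto simp: abs_mult mult_left_le)
    have "(1 - s - t * a) *\<^sub>R x + ((s + t * a - t * c) *\<^sub>R y + (t * c) *\<^sub>R z) \<in> S"
    proof -
      have "\<exists>v\<in>S. (s + t * a - t * c) *\<^sub>R y + (t * c) *\<^sub>R z = (s + t * a) *\<^sub>R v"
      proof -
        have pos: "s + t * a > 0" using ta t by auto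
        let ?q = "t * c / (s + t * a)"
        have "t * c \<le> s + t * a" using ta tc t by linarith
        then have "?q \<le> 1" "0 \<le> ?q" using pos tc by simp_all
        then have "(1 - ?q) *\<^sub>R y + ?q *\<^sub>R z \<in> S"
          using convexD_alt[OF convS S(2,3)] by auto
        moreover have "(s + t * a) *\<^sub>R ((1 - ?q) *\<^sub>R y + ?q *\<^sub>R z)
              = ((s + t * a) * (1 - ?q)) *\<^sub>R y + ((s + t * a) * ?q) *\<^sub>R z"
          by (simp only: scaleR_right_distrib scaleR_scaleR)
        moreover have "(s + t * a) * ?q = t * c" using pos by simp
        moreover then have "(s + t * a) * (1 - ?q) = s + t * a - t * c"
          unfolding right_diff_distrib by simp
        ultimately show ?thesis by metis
      qed
      then obtain v where v: "v \<in> S"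
        "(s + t * a - t * c) *\<^sub>R y + (t * c) *\<^sub>R z = (s + t * a) *\<^sub>R v" by blast
      have "0 \<le> 1 - s - t * a" "0 \<le> s + t * a" using ta t by auto
      then show ?thesis unfolding v(2) by (intro convexD[OF convS S(1) v(1)]) auto
    qed
    also have "(1 - s - t * a) *\<^sub>R x + ((s + t * a - t * c) *\<^sub>R y + (t * c) *\<^sub>R z)
        = w + t *\<^sub>R (a *\<^sub>R d + c *\<^sub>R e)"
      by (simp add: w_def d_def e_def algebra_simps)
    finally show "w + t *\<^sub>R (a *\<^sub>R d + c *\<^sub>R e) \<in> S" .
  qed (use s in auto)
  note bounds = second_derivative_bounds_feasible_direction[OF cvx diff lip D[OF w] w]
  have d: "0 \<le> D w d \<bullet> d" using bounds(1)[OF _ feas[where c = 0 and a = 1]] by simp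
  have e: "0 \<le> D w e \<bullet> e" using bounds(1)[OF _ feas[where c = 1 and a = 0]] by simp
  have "D w (e - d) \<bullet> (e - d) \<le> B * (norm (e - d))\<^sup>2"
    using bounds(2)[OF _ feas[where c = 1 and a = "-1"]] by simp
  moreover have "D w (e - d) \<bullet> (e - d) = D w e \<bullet> e + D w d \<bullet> d - 2 * (D w d \<bullet> e)"
  proof -
    have "D w e \<bullet> d = D w d \<bullet> e"
      using twice[OF w] D[OF w] unfolding twice_differentiable_at_def
      by (intro second_derivative_symmetric) auto
    then show ?thesis by (simp add: linear_diff[OF lin] inner_diff_left inner_diff_right)
  qed
  ultimately have "- (B / 2) * (norm (e - d))\<^sup>2 \<le> D w d \<bullet> e" using d e by simp
  also have "\<dots> = (gradient f y - gradient f x) \<bullet> e"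
    using mvt by (simp add: w_def d_def inner_diff_left)
  finally show ?thesis by (simp add: d_def e_def)
qed

section \<open>Symmetric matrices and their largest eigenvalue\<close>

lemma inner_symmetric_matrix:
  fixes Q :: "real^'n^'n"
  assumes "transpose Q = Q"
  shows "x \<bullet> (Q *v y) = (Q *v x) \<bullet> y"
  using dot_lmul_matrix[of x Q y] transpose_matrix_vector[of Q x] assms by simp

lemma inner_gram_matrix:
  fixes A :: "real^'n^'m"
  shows "x \<bullet> ((transpose A ** A) *v y) = (A *v x) \<bullet> (A *v y)"
  using dot_lmul_matrix[of x "transpose A" "A *v y"] vector_transpose_matrix[of x A]
  by (simp add: matrix_vector_mul_assoc)

lemma transpose_gram_matrix:
  fixes A :: "real^'n^'m"
  shows "transpose (transpose A ** A) = transpose A ** A"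
  by (simp add: matrix_transpose_mul)

text \<open>Eigenvectors to distinct eigenvalues are orthogonal, hence linearly independent. Finiteness
is what makes the \<open>Max\<close> in \<open>lambda_max\<close> meaningful.\<close>
lemma finite_eigenvalues_symmetric:
  fixes S :: "real^'n^'n"
  assumes S: "transpose S = S"
  shows "finite {l. \<exists>v. v \<noteq> 0 \<and> S *v v = l *\<^sub>R v}" (is "finite ?E")
proof -
  obtain e where e: "\<And>l. l \<in> ?E \<Longrightarrow> e l \<noteq> 0 \<and> S *v e l = l *\<^sub>R e l"
  proof -
    have "\<forall>l\<in>?E. \<exists>v. v \<noteq> 0 \<and> S *v v = l *\<^sub>R v" by blast
    from bchoice[OF this] show ?thesis using that by blast
  qed
  have orth: "e l \<bullet> e l' = 0" if "l \<in> ?E" "l' \<in> ?E" "l \<noteq> l'" for l l'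
  proof -
    have "l * (e l \<bullet> e l') = l' * (e l \<bullet> e l')"
      using inner_symmetric_matrix[OF S, of "e l" "e l'"]
      unfolding conjunct2[OF e[OF that(1)]] conjunct2[OF e[OF that(2)]]
      by (simp only: inner_scaleR_left inner_scaleR_right)
    then show ?thesis using that(3) mult_right_cancel[of "e l \<bullet> e l'" l l'] by blast
  qed
  have "inj_on e ?E"
  proof (rule inj_onI, rule ccontr)
    fix l l' assume l: "l \<in> ?E" "l' \<in> ?E" "e l = e l'" "l \<noteq> l'"
    then have "e l \<bullet> e l = 0" using orth[OF l(1,2,4)] by simp
    then show False using e[OF l(1)] by simp
  qed
  moreover have "pairwise orthogonal (e ` ?E)"
    using orth unfolding pairwise_def orthogonal_def by blast
  then have "independent (e ` ?E)"
    by (rule pairwise_orthogonal_independent) (use e in force)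
  then have "finite (e ` ?E)" using independent_bound by blast
  ultimately show ?thesis using finite_imageD by blast
qed

text \<open>The Rayleigh quotient attains its maximum \<open>l\<close> at some unit vector \<open>v\<close>. If
\<open>g = S v - l v\<close> were nonzero, moving from \<open>v\<close> a little in direction \<open>g\<close> would increase the
quotient, so \<open>l\<close> is an eigenvalue.\<close>
lemma quadratic_form_le_lambda_max:
  fixes S :: "real^'n^'n"
  assumes S: "transpose S = S"
  shows "x \<bullet> (S *v x) \<le> lambda_max S * (norm x)\<^sup>2"
proof -
  have "\<exists>v\<in>sphere 0 1. \<forall>y\<in>sphere 0 1. y \<bullet> (S *v y) \<le> v \<bullet> (S *v v)"
    by (rule continuous_attains_sup) (auto intro!: continuous_intros matrix_vector_mult_linear_continuous_on)
  then obtain v where v: "norm v = 1" "\<And>y. norm y = 1 \<Longrightarrow> y \<bullet> (S *v y) \<le> v \<bullet> (S *v v)"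
    by auto
  define l where "l = v \<bullet> (S *v v)"
  have le: "y \<bullet> (S *v y) \<le> l * (norm y)\<^sup>2" for y
  proof (cases "y = 0")
    case False
    then have "sgn y \<bullet> (S *v sgn y) \<le> l" using v(2) by (simp add: norm_sgn l_def)
    moreover have "y \<bullet> (S *v y) = (norm y)\<^sup>2 * (sgn y \<bullet> (S *v sgn y))"
    proof -
      have y: "y = norm y *\<^sub>R sgn y" using False by (simp add: sgn_div_norm)
      show ?thesis
        by (subst (1 2) y) (simp add: matrix_vector_mult_scaleR power2_eq_square)
    qed
    ultimately show ?thesis
      by (metis mult.commute mult_left_mono zero_le_power2)
  qed simp
  have ev: "S *v v = l *\<^sub>R v"
  proof (rule ccontr)
    assume "S *v v \<noteq> l *\<^sub>R v"
    define g where "g = S *v v - l *\<^sub>R v"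
    define C where "C = l * (norm g)\<^sup>2 - g \<bullet> (S *v g)"
    have g: "(norm g)\<^sup>2 > 0" using \<open>S *v v \<noteq> l *\<^sub>R v\<close> by (simp add: g_def)
    have bound: "2 * (norm g)\<^sup>2 \<le> t * C" if "t > 0" for t
    proof -
      have "(v + t *\<^sub>R g) \<bullet> (S *v (v + t *\<^sub>R g)) = l + 2 * t * ((S *v v) \<bullet> g) + t\<^sup>2 * (g \<bullet> (S *v g))"
        using inner_symmetric_matrix[OF S, of v g]
        by (simp add: matrix_vector_right_distrib matrix_vector_mult_scaleR inner_add_left inner_add_right
            l_def power2_eq_square inner_commute distrib_left)
      moreover have "l * (norm (v + t *\<^sub>R g))\<^sup>2 = l + 2 * t * ((l *\<^sub>R v) \<bullet> g) + t\<^sup>2 * (l * (norm g)\<^sup>2)"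
        using v(1) unfolding power2_norm_eq_inner norm_eq_1
        by (simp add: inner_add_left inner_add_right power2_eq_square inner_commute algebra_simps)
      ultimately have "2 * t * ((S *v v - l *\<^sub>R v) \<bullet> g) \<le> t\<^sup>2 * C"
        using le[of "v + t *\<^sub>R g"] by (simp add: C_def inner_diff_left algebra_simps)
      then have "t * (2 * (norm g)\<^sup>2) \<le> t * (t * C)"
        unfolding g_def[symmetric] power2_norm_eq_inner
        by (simp only: power2_eq_square mult.assoc mult.left_commute)
      then show ?thesis using that by simp
    qed
    have C: "C > 0" using bound[OF zero_less_one] g by linarith
    \<comment> \<open>The choice \<open>t = \<parallel>g\<parallel>\<^sup>2 / C\<close> makes the bound contradictory.\<close>
    then have "2 * (norm g)\<^sup>2 \<le> (norm g)\<^sup>2 / C * C" using g by (intro bound) simp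
    then show False using C g by simp
  qed
  have "l \<in> {l. \<exists>v. v \<noteq> 0 \<and> S *v v = l *\<^sub>R v}" using ev v(1) by (intro CollectI exI[of _ v]) auto
  then have "l \<le> lambda_max S"
    unfolding lambda_max_def by (rule Max_ge[OF finite_eigenvalues_symmetric[OF S]])
  with le[of x] show ?thesis by (meson mult_right_mono order_trans zero_le_power2)
qed

section \<open>Lagrange multipliers, and rates of summable monotone sequences\<close>

text \<open>Separate the origin from the convex set of all pairs (constraint value, number above
\<open>F x - m\<close>). The component \<open>\<tau>\<close> of the normal along the second coordinate cannot vanish, since
the constraint values fill a neighbourhood of the origin; dividing by \<open>\<tau>\<close> gives the multiplier.\<close>
lemma lagrange_multiplier_exists:
  fixes A :: "'a::real_vector \<Rightarrow> 'b::euclidean_space"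
  assumes lin: "linear A" and cvx: "convex_on D F"
    and slater: "0 \<in> interior ((\<lambda>x. A x - b) ` D)"
    and lower: "\<And>x. x \<in> D \<Longrightarrow> A x = b \<Longrightarrow> m \<le> F x"
  shows "\<exists>l. \<forall>x\<in>D. m \<le> F x + l \<bullet> (A x - b)"
proof -
  define S where "S = {(A x - b, s) |x s. x \<in> D \<and> F x - m < s}"
  have "convex S"
  proof (rule convexI)
    fix z z' and t t' :: real
    assume z: "z \<in> S" "z' \<in> S" and t: "0 \<le> t" "0 \<le> t'" "t + t' = 1"
    obtain x s where x: "z = (A x - b, s)" "x \<in> D" "F x - m < s" using z(1) by (auto simp: S_def)
    obtain x' s' where x': "z' = (A x' - b, s')" "x' \<in> D" "F x' - m < s'" using z(2) by (auto simp: S_def)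
    let ?y = "t *\<^sub>R x + t' *\<^sub>R x'"
    have "t * (F x - m) + t' * (F x' - m) < t * s + t' * s'"
    proof (cases "t = 0")
      case False
      then have "t * (F x - m) < t * s" "t' * (F x' - m) \<le> t' * s'"
        using x x' t by (auto intro: mult_left_mono)
      then show ?thesis by linarith
    qed (use x' t in simp)
    moreover have "F ?y \<le> t * F x + t' * F x'"
      using cvx x x' t unfolding convex_on_def by blast
    moreover have "t * m + t' * m = m" using t(3) by (simp add: distrib_right[symmetric])
    ultimately have "F ?y - m < t * s + t' * s'" by (simp add: right_diff_distrib)
    moreover have "?y \<in> D" using cvx x x' t unfolding convex_on_def convex_def by blast
    moreover have "t *\<^sub>R b + t' *\<^sub>R b = b" using t(3) by (simp add: scaleR_left_distrib[symmetric])
    then have "t *\<^sub>R z + t' *\<^sub>R z' = (A ?y - b, t * s + t' * s')"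
      using x x' by (simp add: linear_add[OF lin] linear_scale[OF lin] algebra_simps)
    ultimately show "t *\<^sub>R z + t' *\<^sub>R z' \<in> S" unfolding S_def by blast
  qed
  moreover have "0 \<notin> S"
    using lower by (force simp: S_def zero_prod_def)
  ultimately obtain n where n: "n \<noteq> 0" "\<forall>z\<in>S. 0 \<le> n \<bullet> z"
    using separating_hyperplane_set_0 by blast
  obtain y \<tau> where y: "n = (y, \<tau>)" by (cases n)
  have sep: "0 \<le> y \<bullet> (A x - b) + \<tau> * s" if "x \<in> D" "F x - m < s" for x s
    using n(2) that unfolding S_def y by (force simp: inner_prod_def)
  obtain r where r: "r > 0" "ball 0 r \<subseteq> (\<lambda>x. A x - b) ` D"
    using slater by (auto simp: mem_interior)
  obtain x0 where x0: "x0 \<in> D" "A x0 = b"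
    using subsetD[OF interior_subset slater] by auto
  have "0 \<le> \<tau> * (F x0 - m + 1)" using sep[OF x0(1), of "F x0 - m + 1"] x0 by simp
  then have \<tau>0: "\<tau> \<ge> 0" using lower[OF x0] by (simp add: zero_le_mult_iff)
  \<comment> \<open>Otherwise \<open>y\<close> would be nonzero, and a constraint value in direction \<open>- y\<close> violates \<open>sep\<close>.\<close>
  have "\<tau> \<noteq> 0"
  proof
    assume "\<tau> = 0"
    then have "y \<noteq> 0" using n(1) y by (auto simp: zero_prod_def)
    define z where "z = - (r / 2 / norm y) *\<^sub>R y"
    have "norm z < r" using r(1) \<open>y \<noteq> 0\<close> by (simp add: z_def)
    then have "z \<in> (\<lambda>x. A x - b) ` D" using r(2) by auto
    then obtain x where "x \<in> D" "A x - b = z" by auto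
    then have "0 \<le> y \<bullet> z" using sep[of x "F x - m + 1"] \<open>\<tau> = 0\<close> by simp
    moreover have "y \<bullet> z < 0" using r(1) \<open>y \<noteq> 0\<close> by (simp add: z_def)
    ultimately show False by simp
  qed
  with \<tau>0 have \<tau>: "\<tau> > 0" by simp
  have "m \<le> F x + (y /\<^sub>R \<tau>) \<bullet> (A x - b)" if x: "x \<in> D" for x
  proof (rule field_le_epsilon)
    fix e :: real assume "e > 0"
    then have "0 \<le> y \<bullet> (A x - b) + \<tau> * (F x - m + e)" by (intro sep[OF x]) simp
    then show "m \<le> F x + (y /\<^sub>R \<tau>) \<bullet> (A x - b) + e"
      using \<tau> by (simp add: divide_simps algebra_simps)
  qed
  then show ?thesis by blast
qed

text \<open>Each of the at least \<open>n/2\<close> terms with index in \<open>{n div 2..<n}\<close> is at least \<open>a n\<close>, and their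
sum is a difference of two partial sums with the same limit.\<close>
lemma decseq_summable_smallo:
  fixes a :: "nat \<Rightarrow> real"
  assumes dec: "decseq a" and sum: "summable a" and nonneg: "\<And>n. 0 \<le> a n"
  shows "a \<in> o(\<lambda>n. 1 / real n)"
proof -
  let ?S = "\<lambda>n. \<Sum>i<n. a i"
  have S: "?S \<longlonglongrightarrow> suminf a" using sum by (rule summable_LIMSEQ)
  have "filterlim (\<lambda>n::nat. n div 2) at_top sequentially"
    by (rule filterlim_at_top_div_const_nat) simp
  then have "(\<lambda>n. ?S (n div 2)) \<longlonglongrightarrow> suminf a"
    by (rule filterlim_compose[OF S])
  with S have "(\<lambda>n. 2 * (?S n - ?S (n div 2))) \<longlonglongrightarrow> 2 * (suminf a - suminf a)"
    by (intro tendsto_intros)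
  then have lim: "(\<lambda>n. 2 * (?S n - ?S (n div 2))) \<longlonglongrightarrow> 0" by simp
  have "(\<lambda>n. real n * a n) \<longlonglongrightarrow> 0"
  proof (rule tendsto_sandwich[OF _ _ tendsto_const lim])
    show "\<forall>\<^sub>F n in sequentially. 0 \<le> real n * a n" using nonneg by simp
    show "\<forall>\<^sub>F n in sequentially. real n * a n \<le> 2 * (?S n - ?S (n div 2))"
    proof (rule always_eventually, rule allI)
      fix n
      have "real n * a n \<le> 2 * (real (n - n div 2) * a n)"
        using nonneg[of n] by (simp add: mult.assoc[symmetric] mult_right_mono)
      also have "real (n - n div 2) * a n = (\<Sum>i\<in>{n div 2..<n}. a n)" by simp
      also have "\<dots> \<le> (\<Sum>i\<in>{n div 2..<n}. a i)"
        using dec by (intro sum_mono) (auto simp: decseq_def)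
      also have "\<dots> = ?S n - ?S (n div 2)"
        using sum_diff_nat_ivl[of 0 "n div 2" n a] by (simp add: lessThan_atLeast0)
      finally show "real n * a n \<le> 2 * (?S n - ?S (n div 2))" by simp
    qed
  qed
  then show ?thesis
    by (intro smalloI_tendsto) (auto simp: mult.commute intro: eventually_mono[OF eventually_gt_at_top[of 0]])
qed

section \<open>The proximal linearized augmented Lagrangian iteration\<close>

text \<open>The iteration with the core function eliminated. The set \<open>D\<close> is the part of the constraint set
where the nonsmooth term is finite and \<open>j\<close> is that term on \<open>D\<close>. The assumption \<open>optimality\<close> is
the variational inequality that characterizes \<open>u (Suc k)\<close>, with the multiplier estimate already
taken at the new point. The constant \<open>\<kappa>\<close> is the surplus of the metric \<open>Q\<close> over \<open>B\<close>, available only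
for differences of points of \<open>U\<close>.\<close>
locale linearized_augmented_lagrangian =
  fixes U D :: "(real^'n) set" and G j :: "real^'n \<Rightarrow> real"
    and A :: "real^'n^'m" and b :: "real^'m" and Q :: "real^'n^'n"
    and B \<kappa> \<gamma> \<rho> :: real
    and u :: "nat \<Rightarrow> real^'n" and p :: "nat \<Rightarrow> real^'m"
  assumes D_sub: "D \<subseteq> U" and convex_G: "convex_on U G" and convex_j: "convex_on D j"
    and twice: "\<And>x. x \<in> U \<Longrightarrow> twice_differentiable_at G x"
    and lip: "B-lipschitz_on U (gradient G)"
    and Q_sym: "transpose Q = Q"
    and Q_ge: "\<And>x. B * (norm x)\<^sup>2 \<le> x \<bullet> (Q *v x)"
    and \<kappa>: "\<kappa> > 0"
    and Q_gap: "\<And>x y. x \<in> U \<Longrightarrow> y \<in> U \<Longrightarrow> (B + \<kappa>) * (norm (x - y))\<^sup>2 \<le> (x - y) \<bullet> (Q *v (x - y))"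
    and slater: "0 \<in> interior ((\<lambda>x. A *v x - b) ` D)"
    and bounded_sublevel: "\<And>C. bounded {x \<in> D. G x + j x \<le> C}"
    and \<gamma>: "\<gamma> > 0" and \<rho>: "\<rho> > 0" "\<rho> < 2 * \<gamma>"
    and u_U: "\<And>k. u k \<in> U" and u_D: "\<And>k. u (Suc k) \<in> D"
    and optimality: "\<And>k v. v \<in> D \<Longrightarrow>
      0 \<le> gradient G (u k) \<bullet> (v - u (Suc k)) + j v - j (u (Suc k))
           + (p k + \<gamma> *\<^sub>R (A *v u (Suc k) - b)) \<bullet> (A *v (v - u (Suc k)))
           + (Q *v (u (Suc k) - u k)) \<bullet> (v - u (Suc k))"
    and p_step: "\<And>k. p (Suc k) = p k + \<rho> *\<^sub>R (A *v u (Suc k) - b)"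
begin

definition r :: "nat \<Rightarrow> real^'m" where "r k = A *v u k - b"

text \<open>The second summand belongs to the step that produces the residual in the first one, so that
\<open>residual_energy t\<close> bounds both \<open>u t - u (t + 1)\<close> and \<open>p t - p (t + 1)\<close>.\<close>
definition residual_energy :: "nat \<Rightarrow> real" where
  "residual_energy k = \<rho> / 2 * (norm (r (Suc k)))\<^sup>2
     + 1 / 2 * ((u (Suc k) - u k) \<bullet> (Q *v (u (Suc k) - u k)))"

lemma B_nonneg: "0 \<le> B"
  using lip by (rule lipschitz_on_nonneg)

lemma diff_G: "x \<in> U \<Longrightarrow> G differentiable (at x)"
  using twice unfolding twice_differentiable_at_def by (auto dest: eventually_nhds_x_imp_x)

lemma Q_nonneg: "0 \<le> x \<bullet> (Q *v x)"
  by (rule order_trans[OF mult_nonneg_nonneg[OF B_nonneg zero_le_power2] Q_ge])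

lemma Q_three_points:
  "(Q *v (w - x)) \<bullet> (v - w) = 1/2 * ((x - v) \<bullet> (Q *v (x - v))) - 1/2 * ((w - v) \<bullet> (Q *v (w - v)))
     - 1/2 * ((w - x) \<bullet> (Q *v (w - x)))"
proof -
  have "x - v = - ((w - x) + (v - w))" "w - v = - (v - w)" by simp_all
  then show ?thesis
    using inner_symmetric_matrix[OF Q_sym, of "w - x" "v - w"]
    by (simp only: linear_neg[OF matrix_vector_mul_linear] inner_minus_left inner_minus_right
        matrix_vector_right_distrib inner_add_left inner_add_right) (simp add: inner_commute field_simps)
qed

text \<open>Adding the optimality condition of step \<open>k\<close> tested at \<open>u (k + 2)\<close> to that of step \<open>k + 1\<close>
tested at \<open>u (k + 1)\<close> cancels \<open>j\<close>. The inner products with \<open>Q\<close> and with the residuals are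
telescoping squares, and the difference of gradients is absorbed by \<open>\<parallel>e - d\<parallel>\<^sup>2\<close> in the metric \<open>Q\<close>.\<close>
lemma residual_energy_antimono: "residual_energy (Suc k) \<le> residual_energy k"
proof -
  let ?x = "u k" and ?y = "u (Suc k)" and ?z = "u (Suc (Suc k))"
  let ?r = "r (Suc k)" and ?s = "r (Suc (Suc k))"
  define d where "d = ?y - ?x"
  define e where "e = ?z - ?y"
  have Ae: "A *v e = ?s - ?r" by (simp add: e_def r_def matrix_vector_mult_diff_distrib)
  have "0 \<le> gradient G ?y \<bullet> (- e) + j ?y - j ?z + (p (Suc k) + \<gamma> *\<^sub>R ?s) \<bullet> (A *v (- e)) + (Q *v e) \<bullet> (- e)"
    using optimality[OF u_D, of "Suc k" k] by (simp add: e_def r_def)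
  moreover have "0 \<le> gradient G ?x \<bullet> e + j ?z - j ?y + (p k + \<gamma> *\<^sub>R ?r) \<bullet> (A *v e) + (Q *v d) \<bullet> e"
    using optimality[OF u_D, of k "Suc k"] by (simp add: e_def d_def r_def)
  moreover have "p (Suc k) = p k + \<rho> *\<^sub>R ?r" using p_step by (simp add: r_def)
  ultimately have sum: "(gradient G ?y - gradient G ?x) \<bullet> e
      + \<rho> * (?r \<bullet> (?s - ?r)) + \<gamma> * ((?s - ?r) \<bullet> (?s - ?r)) + (Q *v (e - d)) \<bullet> e \<le> 0"
    by (simp add: linear_neg[OF matrix_vector_mul_linear] Ae inner_diff_left inner_add_left
        matrix_vector_mult_diff_distrib algebra_simps)
  have "- (B / 2) * (norm (e - d))\<^sup>2 \<le> (gradient G ?y - gradient G ?x) \<bullet> e"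
    unfolding d_def e_def by (rule gradient_three_point_lower_bound[OF convex_G twice lip u_U u_U u_U])
  moreover have "B * (norm (e - d))\<^sup>2 \<le> (e - d) \<bullet> (Q *v (e - d))" by (rule Q_ge)
  moreover have "(Q *v (e - d)) \<bullet> e
      = 1/2 * (e \<bullet> (Q *v e)) - 1/2 * (d \<bullet> (Q *v d)) + 1/2 * ((e - d) \<bullet> (Q *v (e - d)))"
    using Q_three_points[of e d 0] by (simp add: linear_neg[OF matrix_vector_mul_linear])
  moreover have "?r \<bullet> (?s - ?r) = 1/2 * (norm ?s)\<^sup>2 - 1/2 * (norm ?r)\<^sup>2 - 1/2 * (norm (?s - ?r))\<^sup>2"
    by (simp add: power2_norm_eq_inner inner_diff_left inner_diff_right inner_commute field_simps)
  then have "\<rho> * (?r \<bullet> (?s - ?r))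
      = \<rho> * (1/2 * (norm ?s)\<^sup>2 - 1/2 * (norm ?r)\<^sup>2 - 1/2 * (norm (?s - ?r))\<^sup>2)"
    by (rule arg_cong)
  then have "\<rho> * (?r \<bullet> (?s - ?r))
      = \<rho> / 2 * (norm ?s)\<^sup>2 - \<rho> / 2 * (norm ?r)\<^sup>2 - \<rho> / 2 * (norm (?s - ?r))\<^sup>2"
    by (simp add: right_diff_distrib)
  moreover have "0 \<le> (\<gamma> - \<rho> / 2) * (norm (?s - ?r))\<^sup>2" using \<rho> by simp
  then have "\<rho> / 2 * (norm (?s - ?r))\<^sup>2 \<le> \<gamma> * ((?s - ?r) \<bullet> (?s - ?r))"
    by (simp add: power2_norm_eq_inner left_diff_distrib)
  ultimately have "\<rho> / 2 * (norm ?s)\<^sup>2 + 1/2 * (e \<bullet> (Q *v e)) \<le> \<rho> / 2 * (norm ?r)\<^sup>2 + 1/2 * (d \<bullet> (Q *v d))"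
    using sum by linarith
  then show ?thesis by (simp add: residual_energy_def d_def e_def)
qed

text \<open>Convexity of \<open>G\<close> at \<open>u k\<close> and the descent lemma from \<open>u k\<close> to \<open>u (Suc k)\<close> replace the
linearization of \<open>G\<close> by true values, at the cost of \<open>B/2 \<parallel>u (Suc k) - u k\<parallel>\<^sup>2\<close>.\<close>
lemma objective_decrease:
  assumes v: "v \<in> D" "A *v v = b"
  shows "G (u (Suc k)) + j (u (Suc k)) - (G v + j v) + (p k + \<gamma> *\<^sub>R r (Suc k)) \<bullet> r (Suc k)
    \<le> 1/2 * ((u k - v) \<bullet> (Q *v (u k - v))) - 1/2 * ((u (Suc k) - v) \<bullet> (Q *v (u (Suc k) - v)))
      - \<kappa> / 2 * (norm (u (Suc k) - u k))\<^sup>2"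
proof -
  let ?x = "u k" and ?w = "u (Suc k)"
  have vU: "v \<in> U" using v D_sub by blast
  have "G ?x + gradient G ?x \<bullet> (v - ?x) \<le> G v"
    by (rule convex_on_above_gradient[OF convex_G u_U vU diff_G[OF u_U]])
  moreover have "G ?w \<le> G ?x + gradient G ?x \<bullet> (?w - ?x) + B / 2 * (norm (?w - ?x))\<^sup>2"
    using convex_G by (intro lipschitz_gradient_upper_bound[OF _ diff_G lip u_U u_U]) (simp_all add: convex_on_def)
  ultimately have "gradient G ?x \<bullet> (v - ?w) \<le> G v - G ?w + B / 2 * (norm (?w - ?x))\<^sup>2"
    by (simp add: inner_diff_right)
  moreover have "A *v (v - ?w) = - r (Suc k)"
    using v(2) by (simp add: r_def matrix_vector_mult_diff_distrib)
  then have "0 \<le> gradient G ?x \<bullet> (v - ?w) + j v - j ?w - (p k + \<gamma> *\<^sub>R r (Suc k)) \<bullet> r (Suc k)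
       + (Q *v (?w - ?x)) \<bullet> (v - ?w)"
    using optimality[OF v(1), of k] by (simp only: r_def inner_minus_right)
  moreover have "(B + \<kappa>) * (norm (?w - ?x))\<^sup>2 \<le> (?w - ?x) \<bullet> (Q *v (?w - ?x))"
    by (rule Q_gap[OF u_U u_U])
  then have "B / 2 * (norm (?w - ?x))\<^sup>2 + \<kappa> / 2 * (norm (?w - ?x))\<^sup>2
      \<le> 1/2 * ((?w - ?x) \<bullet> (Q *v (?w - ?x)))" by (simp add: algebra_simps)
  ultimately show ?thesis unfolding Q_three_points by linarith
qed

definition lyapunov :: "real^'n \<Rightarrow> real^'m \<Rightarrow> nat \<Rightarrow> real" where
  "lyapunov v l k = 1/2 * ((u k - v) \<bullet> (Q *v (u k - v))) + 1 / (2 * \<rho>) * (norm (p k - l))\<^sup>2"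

definition gain :: "nat \<Rightarrow> real" where
  "gain k = (\<gamma> - \<rho> / 2) * (norm (r (Suc k)))\<^sup>2 + \<kappa> / 2 * (norm (u (Suc k) - u k))\<^sup>2"

lemma lyapunov_nonneg: "0 \<le> lyapunov v l k"
  using Q_nonneg \<rho> by (simp add: lyapunov_def)

lemma gain_nonneg: "0 \<le> gain k"
  using \<rho> \<kappa> by (simp add: gain_def)

text \<open>The point \<open>v\<close> is only required to be feasible. Its optimality gap \<open>G v + j v - m\<close> appears as an
error term that can be made small.\<close>
lemma lyapunov_decrease:
  assumes v: "v \<in> D" "A *v v = b"
    and l: "\<And>x. x \<in> D \<Longrightarrow> m \<le> G x + j x + l \<bullet> (A *v x - b)"
  shows "lyapunov v l (Suc k) + gain k \<le> lyapunov v l k + (G v + j v - m)"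
proof -
  let ?r = "r (Suc k)"
  have "m \<le> G (u (Suc k)) + j (u (Suc k)) + l \<bullet> ?r" using l[OF u_D] by (simp add: r_def)
  moreover have "1 / (2 * \<rho>) * (norm (p (Suc k) - l))\<^sup>2
      = 1 / (2 * \<rho>) * (norm (p k - l))\<^sup>2 + (p k - l) \<bullet> ?r + \<rho> / 2 * (norm ?r)\<^sup>2"
  proof -
    have "p (Suc k) - l = (p k - l) + \<rho> *\<^sub>R ?r" using p_step by (simp add: r_def)
    then have "(norm (p (Suc k) - l))\<^sup>2
        = (norm (p k - l))\<^sup>2 + 2 * \<rho> * ((p k - l) \<bullet> ?r) + \<rho>\<^sup>2 * (norm ?r)\<^sup>2"
      unfolding \<open>p (Suc k) - l = _\<close> power2_norm_eq_inner
      by (simp add: inner_add_left inner_add_right inner_commute power2_eq_square distrib_left)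
    then have "1 / (2 * \<rho>) * (norm (p (Suc k) - l))\<^sup>2 = 1 / (2 * \<rho>) *
        ((norm (p k - l))\<^sup>2 + 2 * \<rho> * ((p k - l) \<bullet> ?r) + \<rho>\<^sup>2 * (norm ?r)\<^sup>2)" by (rule arg_cong)
    then show ?thesis using \<rho>(1) by (simp only: distrib_left) (simp add: power2_eq_square)
  qed
  moreover have "(p k + \<gamma> *\<^sub>R ?r) \<bullet> ?r = (p k - l) \<bullet> ?r + l \<bullet> ?r + \<gamma> * (norm ?r)\<^sup>2"
    by (simp add: inner_add_left inner_diff_left power2_norm_eq_inner)
  ultimately show ?thesis
    using objective_decrease[OF v, of k] by (simp add: lyapunov_def gain_def left_diff_distrib)
qed

text \<open>The optimality condition of the very first step is an affine minorant of \<open>j\<close>, and the gradient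
of \<open>G\<close> gives one of \<open>G\<close>. An affine function is bounded below on a bounded sublevel set, and
outside that set the objective is large by definition.\<close>
lemma objective_bounded_below: "\<exists>m0. \<forall>x\<in>D. m0 \<le> G x + j x"
proof -
  let ?w = "u (Suc 0)"
  have wU: "?w \<in> U" by (rule u_U)
  define q where "q = p 0 + \<gamma> *\<^sub>R (A *v ?w - b)"
  \<comment> \<open>The slope of the affine minorant of the objective that touches it at \<open>u 1\<close>.\<close>
  define a where "a = gradient G ?w - gradient G (u 0) - q v* A - Q *v (?w - u 0)"
  have minorant: "G ?w + j ?w + a \<bullet> (x - ?w) \<le> G x + j x" if x: "x \<in> D" for x
  proof -
    have "q \<bullet> (A *v (x - ?w)) = (q v* A) \<bullet> (x - ?w)" by (rule dot_lmul_matrix[symmetric])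
    then have "a \<bullet> (x - ?w) \<le> gradient G ?w \<bullet> (x - ?w) + j x - j ?w"
      using optimality[OF x, of 0] by (simp add: a_def q_def inner_diff_left)
    moreover have "G ?w + gradient G ?w \<bullet> (x - ?w) \<le> G x"
      using D_sub x by (intro convex_on_above_gradient[OF convex_G wU _ diff_G[OF wU]]) blast
    ultimately show ?thesis by simp
  qed
  obtain R where R: "\<And>x. x \<in> D \<Longrightarrow> G x + j x \<le> G ?w + j ?w \<Longrightarrow> norm x \<le> R"
    using bounded_sublevel[of "G ?w + j ?w"] unfolding bounded_iff by auto
  have R0: "0 \<le> R" using R[OF u_D[of 0] order_refl] by (intro order_trans[OF norm_ge_zero]) auto
  have "G ?w + j ?w - norm a * (R + norm ?w) \<le> G x + j x" if x: "x \<in> D" for x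
  proof (cases "G x + j x \<le> G ?w + j ?w")
    case True
    have "\<bar>a \<bullet> (x - ?w)\<bar> \<le> norm a * norm (x - ?w)" by (rule Cauchy_Schwarz_ineq2)
    also have "\<dots> \<le> norm a * (R + norm ?w)"
      using R[OF x True] norm_triangle_ineq4[of x ?w] by (intro mult_left_mono) auto
    finally show ?thesis using minorant[OF x] by linarith
  next
    case False
    have "0 \<le> norm a * (R + norm ?w)" using R0 by simp
    then show ?thesis using False by linarith
  qed
  then show ?thesis by blast
qed

text \<open>Over \<open>T\<close> steps the error terms of \<open>lyapunov_decrease\<close> add up to \<open>T\<close> times the optimality gap
of the comparison point. With a gap below \<open>1/(T + 1)\<close> this is at most one, and the initial value
of the Lyapunov function is bounded uniformly over the sublevel set that contains all these
points.\<close>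
lemma summable_gain: "summable gain"
proof -
  let ?F = "\<lambda>x. G x + j x" and ?S = "{x \<in> D. A *v x = b}"
  \<comment> \<open>The optimal value, which need not be attained.\<close>
  define m where "m = Inf (?F ` ?S)"
  obtain m0 where m0: "\<And>x. x \<in> D \<Longrightarrow> m0 \<le> ?F x" using objective_bounded_below by blast
  have bdd: "bdd_below (?F ` ?S)" using m0 by (intro bdd_belowI[of _ m0]) auto
  have ne: "?F ` ?S \<noteq> {}" using subsetD[OF interior_subset slater] by auto
  have m: "m \<le> ?F x" if "x \<in> D" "A *v x = b" for x
    unfolding m_def using that by (intro cInf_lower[OF _ bdd]) auto
  have "convex_on D ?F"
    using convex_G convex_j D_sub
    by (intro convex_on_add convex_on_subset[OF convex_G D_sub] convex_on_imp_convex)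
  then have "\<exists>l. \<forall>x\<in>D. m \<le> ?F x + l \<bullet> (A *v x - b)"
    by (rule lagrange_multiplier_exists[OF matrix_vector_mul_linear _ slater]) (rule m)
  then obtain l where l: "\<And>x. x \<in> D \<Longrightarrow> m \<le> ?F x + l \<bullet> (A *v x - b)" by blast
  obtain R where R: "\<And>x. x \<in> D \<Longrightarrow> ?F x \<le> m + 1 \<Longrightarrow> norm x \<le> R"
    using bounded_sublevel[of "m + 1"] unfolding bounded_iff by auto
  define C where "C = 1/2 * (onorm ((*v) Q) * (norm (u 0) + R)\<^sup>2) + 1 / (2 * \<rho>) * (norm (p 0 - l))\<^sup>2"
  have start: "lyapunov v l 0 \<le> C" if v: "v \<in> D" "?F v \<le> m + 1" for v
  proof -
    let ?d = "u 0 - v"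
    have d: "norm ?d \<le> norm (u 0) + R"
      using R[OF v] norm_triangle_ineq4[of "u 0" v] by linarith
    have "?d \<bullet> (Q *v ?d) \<le> norm ?d * norm (Q *v ?d)" by (rule norm_cauchy_schwarz)
    also have "\<dots> \<le> norm ?d * (onorm ((*v) Q) * norm ?d)"
      by (intro mult_left_mono onorm) auto
    also have "\<dots> = onorm ((*v) Q) * (norm ?d)\<^sup>2" by (simp add: power2_eq_square)
    also have "\<dots> \<le> onorm ((*v) Q) * (norm (u 0) + R)\<^sup>2"
      using d by (intro mult_left_mono power_mono onorm_pos_le) auto
    finally show ?thesis by (simp add: lyapunov_def C_def)
  qed
  have "sum gain {..<T} \<le> C + 1" for T
  proof -
    define \<eta> where "\<eta> = 1 / (real T + 1)"
    have \<eta>: "0 < \<eta>" "\<eta> \<le> 1" "real T * \<eta> \<le> 1" by (auto simp: \<eta>_def divide_simps)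
    have "Inf (?F ` ?S) < m + \<eta>" using \<eta> by (simp add: m_def)
    then obtain v where v: "v \<in> D" "A *v v = b" "?F v < m + \<eta>"
      using cInf_lessD[OF ne] by blast
    have "lyapunov v l t + sum gain {..<t} \<le> lyapunov v l 0 + real t * (?F v - m)" for t
    proof (induction t)
      case (Suc t)
      then show ?case using lyapunov_decrease[OF v(1,2) l, of t] by (simp add: algebra_simps)
    qed simp
    from this[of T] have "sum gain {..<T} \<le> lyapunov v l 0 + real T * (?F v - m)"
      using lyapunov_nonneg[of v l T] by linarith
    also have "\<dots> \<le> C + real T * \<eta>"
    proof (rule add_mono)
      show "lyapunov v l 0 \<le> C" using v(3) \<eta>(2) by (intro start[OF v(1)]) linarith
      show "real T * (?F v - m) \<le> real T * \<eta>" using v(3) by (intro mult_left_mono) linarith+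
    qed
    finally show ?thesis using \<eta> by linarith
  qed
  then show ?thesis
    using gain_nonneg by (intro summableI_nonneg_bounded)
qed

lemma residual_energy_nonneg: "0 \<le> residual_energy k"
  using Q_nonneg \<rho> by (simp add: residual_energy_def)

lemma summable_residual_energy: "summable residual_energy"
proof (rule summable_comparison_test')
  let ?c = "\<rho> / 2 / (\<gamma> - \<rho> / 2) + onorm ((*v) Q) / \<kappa>"
  show "summable (\<lambda>k. ?c * gain k)" by (intro summable_mult summable_gain)
  show "norm (residual_energy k) \<le> ?c * gain k" if "k \<ge> 0" for k
  proof -
    let ?d = "u (Suc k) - u k" and ?a = "(\<gamma> - \<rho> / 2) * (norm (r (Suc k)))\<^sup>2"
    let ?e = "\<kappa> / 2 * (norm (u (Suc k) - u k))\<^sup>2"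
    have g: "0 < \<gamma> - \<rho> / 2" using \<rho> by simp
    have "?d \<bullet> (Q *v ?d) \<le> norm ?d * norm (Q *v ?d)" by (rule norm_cauchy_schwarz)
    also have "\<dots> \<le> norm ?d * (onorm ((*v) Q) * norm ?d)"
      by (intro mult_left_mono onorm) auto
    finally have "1/2 * (?d \<bullet> (Q *v ?d)) \<le> onorm ((*v) Q) / \<kappa> * ?e"
      using \<kappa> by (simp add: power2_eq_square mult.left_commute)
    moreover have "onorm ((*v) Q) / \<kappa> * ?e \<le> onorm ((*v) Q) / \<kappa> * gain k"
      using \<kappa> g by (intro mult_left_mono divide_nonneg_pos onorm_pos_le) (auto simp: gain_def)
    moreover have "x / c * (c * y) = x * y" if "c > 0" for x c y :: real using that by simp
    then have "\<rho> / 2 * (norm (r (Suc k)))\<^sup>2 = \<rho> / 2 / (\<gamma> - \<rho> / 2) * ?a" using g by metis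
    moreover have "\<rho> / 2 / (\<gamma> - \<rho> / 2) * ?a \<le> \<rho> / 2 / (\<gamma> - \<rho> / 2) * gain k"
      using \<kappa> g \<rho> by (intro mult_left_mono) (auto simp: gain_def)
    ultimately have "residual_energy k \<le> ?c * gain k"
      unfolding residual_energy_def distrib_right by linarith
    then show ?thesis using residual_energy_nonneg by simp
  qed
qed

lemma residual_energy_smallo: "residual_energy \<in> o(\<lambda>t. 1 / real t)"
  using residual_energy_antimono summable_residual_energy residual_energy_nonneg
  by (intro decseq_summable_smallo decseq_SucI)

lemma primal_rate: "(\<lambda>t. (qnorm Q (u t - u (t + 1)))\<^sup>2) \<in> o(\<lambda>t. 1 / real t)"
proof (rule landau_o.big_small_trans[OF _ residual_energy_smallo])
  have "(qnorm Q (u t - u (t + 1)))\<^sup>2 = 2 * residual_energy t - \<rho> * (norm (r (Suc t)))\<^sup>2" for t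
  proof -
    have "u t - u (Suc t) = - (u (Suc t) - u t)" by simp
    then have "(u t - u (Suc t)) \<bullet> (Q *v (u t - u (Suc t)))
        = (u (Suc t) - u t) \<bullet> (Q *v (u (Suc t) - u t))"
      by (simp only: linear_neg[OF matrix_vector_mul_linear] inner_minus_left inner_minus_right minus_minus)
    then show ?thesis
      using Q_nonneg[of "u t - u (Suc t)"] by (simp add: qnorm_def residual_energy_def)
  qed
  then have "(qnorm Q (u t - u (t + 1)))\<^sup>2 \<le> 2 * residual_energy t" for t
    using \<rho> by simp
  then show "(\<lambda>t. (qnorm Q (u t - u (t + 1)))\<^sup>2) \<in> O(residual_energy)"
    using residual_energy_nonneg by (intro bigoI[of _ 2] always_eventually allI) simp
qed

lemma dual_rate: "(\<lambda>t. (norm (p t - p (t + 1)))\<^sup>2) \<in> o(\<lambda>t. 1 / real t)"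
proof (rule landau_o.big_small_trans[OF _ residual_energy_smallo])
  have "(norm (p t - p (t + 1)))\<^sup>2 \<le> 2 * \<rho> * residual_energy t" for t
  proof -
    have "(norm (p t - p (t + 1)))\<^sup>2 = \<rho>\<^sup>2 * (norm (r (Suc t)))\<^sup>2"
    proof -
      have "p t - p (t + 1) = - (\<rho> *\<^sub>R r (Suc t))" using p_step[of t] by (simp add: r_def)
      then show ?thesis by (simp only: norm_minus_cancel norm_scaleR power_mult_distrib power2_abs)
    qed
    also have "\<dots> = 2 * \<rho> * (\<rho> / 2 * (norm (r (Suc t)))\<^sup>2)" by (simp add: power2_eq_square)
    also have "\<dots> \<le> 2 * \<rho> * residual_energy t"
      using \<rho> Q_nonneg by (intro mult_left_mono) (auto simp: residual_energy_def)
    finally show ?thesis .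
  qed
  then show "(\<lambda>t. (norm (p t - p (t + 1)))\<^sup>2) \<in> O(residual_energy)"
    using residual_energy_nonneg by (intro bigoI[of _ "2 * \<rho>"] always_eventually allI) simp
qed

end

section \<open>The core function\<close>

text \<open>A quadratic remainder identifies the linear part of the expansion as the derivative.\<close>
lemma bregman_quadratic:
  fixes f :: "'a::euclidean_space \<Rightarrow> real"
  assumes exp: "\<And>d. f (x + d) = f x + L d + q d"
    and L: "linear L" and q: "\<And>d. \<bar>q d\<bar> \<le> C * (norm d)\<^sup>2"
  shows "bregman f y x = q (y - x)"
proof -
  have "(f has_derivative L) (at x)"
    unfolding has_derivative_at_alt
  proof (intro conjI allI impI)
    show "bounded_linear L" using L by (simp add: linear_conv_bounded_linear)
    fix e :: real assume e: "e > 0"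
    show "\<exists>\<delta>>0. \<forall>y. norm (y - x) < \<delta> \<longrightarrow> norm (f y - f x - L (y - x)) \<le> e * norm (y - x)"
    \<comment> \<open>Adding one keeps the radius meaningful when \<open>C = 0\<close>.\<close>
    proof (intro exI[of _ "e / (\<bar>C\<bar> + 1)"] conjI allI impI)
      fix y assume y: "norm (y - x) < e / (\<bar>C\<bar> + 1)"
      have "norm (f y - f x - L (y - x)) = \<bar>q (y - x)\<bar>" using exp[of "y - x"] by simp
      also have "\<dots> \<le> (C * norm (y - x)) * norm (y - x)"
        using q[of "y - x"] by (simp add: power2_eq_square mult.assoc)
      also have "C * norm (y - x) \<le> (\<bar>C\<bar> + 1) * norm (y - x)" by (intro mult_right_mono) auto
      also have "(\<bar>C\<bar> + 1) * norm (y - x) \<le> e" using y by (simp add: field_simps)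
      finally show "norm (f y - f x - L (y - x)) \<le> e * norm (y - x)"
        by (simp add: mult_right_mono)
    qed (use e in simp)
  qed
  moreover from this have "f differentiable (at x)" unfolding differentiable_def by blast
  ultimately have "L = (\<lambda>h. gradient f x \<bullet> h)"
    using has_derivative_gradient has_derivative_unique by blast
  then have "gradient f x \<bullet> (y - x) = L (y - x)" by simp
  then show ?thesis using exp[of "y - x"] by (simp add: bregman_def)
qed

lemma col_blk_mult_blk: "col_blk c i M *v blk c i x = col_blk c i M *v x"
  by (auto simp: vec_eq_iff matrix_vector_mult_def col_blk_def blk_def intro!: sum.cong)

lemma sum_matrix_vector_mult:
  fixes B :: "'i \<Rightarrow> real^'n^'m"
  shows "(\<Sum>i\<in>I. B i) *v x = (\<Sum>i\<in>I. B i *v x)"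
  by (induction I rule: infinite_finite_induct) (auto simp: matrix_vector_mult_add_rdistrib)

text \<open>Matrices supported in their own diagonal blocks may simply be added, which avoids any
splitting of vectors into blocks.\<close>
lemma block_diag_eq_sum:
  fixes c :: "'n::finite \<Rightarrow> 'b::finite" and B :: "'b \<Rightarrow> real^'n^'n"
  assumes "\<And>i j l. c j \<noteq> i \<or> c l \<noteq> i \<Longrightarrow> B i $ j $ l = 0"
  shows "block_diag c B = (\<Sum>i\<in>UNIV. B i)"
proof -
  have "(\<Sum>i\<in>UNIV. B i $ j $ l) = (if c j = c l then B (c j) $ j $ l else 0)" for j l
  proof -
    have "(\<Sum>i\<in>UNIV. B i $ j $ l) = (\<Sum>i\<in>UNIV. if i = c j then (if c j = c l then B (c j) $ j $ l else 0) else 0)"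
      using assms by (intro sum.cong) auto
    then show ?thesis by simp
  qed
  then show ?thesis by (simp add: vec_eq_iff block_diag_def)
qed

lemma H_mat_quadratic_form:
  "x \<bullet> (H_mat c A P \<theta> \<alpha> \<epsilon> *v x) = 1 / \<epsilon> *
     ((\<Sum>i\<in>UNIV. \<theta> i * (norm (col_blk c i A *v x))\<^sup>2)
      + (\<Sum>i\<in>UNIV. \<alpha> i * (norm (col_blk c i (P i) *v x))\<^sup>2))"
proof -
  let ?B = "\<lambda>i. \<theta> i *\<^sub>R (transpose (col_blk c i A) ** col_blk c i A)
     + \<alpha> i *\<^sub>R (transpose (col_blk c i (P i)) ** col_blk c i (P i))"
  have "block_diag c ?B = (\<Sum>i\<in>UNIV. ?B i)"
    by (rule block_diag_eq_sum) (auto simp: matrix_matrix_mult_def transpose_def col_blk_def)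
  then show ?thesis
    by (simp add: H_mat_def scaleR_matrix_vector_assoc[symmetric] sum_matrix_vector_mult
        matrix_vector_mult_add_rdistrib inner_sum_right inner_add_right inner_gram_matrix
        power2_norm_eq_inner sum.distrib)
qed

text \<open>The core function is a quadratic with Hessian \<open>\<epsilon> H\<close>: the iterate \<open>v\<close> enters only its linear
and constant parts, so the Hessian is the same in every iteration.\<close>
lemma core_fun_expansion:
  assumes "\<epsilon> \<noteq> 0"
  shows "\<exists>L. linear L \<and> (\<forall>d. core_fun c A b P \<theta> \<alpha> v (x + d)
      = core_fun c A b P \<theta> \<alpha> v x + L d + \<epsilon> / 2 * (d \<bullet> (H_mat c A P \<theta> \<alpha> \<epsilon> *v d)))"
proof -
  let ?A = "\<lambda>i. col_blk c i A" and ?P = "\<lambda>i. col_blk c i (P i)"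
  define s where "s i = (\<Sum>j\<in>UNIV - {i}. ?A j *v blk c j v) - b" for i
  define L where "L d = (\<Sum>i\<in>UNIV. \<theta> i * ((?A i *v x + s i) \<bullet> (?A i *v d)))
      + (\<Sum>i\<in>UNIV. \<alpha> i * ((?P i *v x) \<bullet> (?P i *v d)))" for d
  have "linear L"
    unfolding L_def
    by (intro linearI) (simp_all add: matrix_vector_right_distrib matrix_vector_mult_scaleR
        inner_add_right distrib_left sum.distrib sum_distrib_left mult.left_commute)
  moreover have sq: "t / 2 * (norm (y + z))\<^sup>2 = t / 2 * (norm y)\<^sup>2 + t * (y \<bullet> z) + t / 2 * (norm z)\<^sup>2"
    for t and y z :: "real^'k::finite"
    by (simp add: power2_norm_eq_inner inner_add_left inner_add_right inner_commute algebra_simps)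
  have sqA: "\<theta> i / 2 * (norm (?A i *v (x + d) + s i))\<^sup>2 = \<theta> i / 2 * (norm (?A i *v x + s i))\<^sup>2
      + \<theta> i * ((?A i *v x + s i) \<bullet> (?A i *v d)) + \<theta> i / 2 * (norm (?A i *v d))\<^sup>2" for i d
    using sq[of "\<theta> i" "?A i *v x + s i" "?A i *v d"]
    by (simp add: matrix_vector_right_distrib add.assoc add.left_commute add.commute)
  have sqP: "\<alpha> i / 2 * (norm (?P i *v (x + d)))\<^sup>2 = \<alpha> i / 2 * (norm (?P i *v x))\<^sup>2
      + \<alpha> i * ((?P i *v x) \<bullet> (?P i *v d)) + \<alpha> i / 2 * (norm (?P i *v d))\<^sup>2" for i d
    unfolding matrix_vector_right_distrib by (rule sq)
  have "core_fun c A b P \<theta> \<alpha> v (x + d) = core_fun c A b P \<theta> \<alpha> v x + L d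
      + ((\<Sum>i\<in>UNIV. \<theta> i / 2 * (norm (?A i *v d))\<^sup>2) + (\<Sum>i\<in>UNIV. \<alpha> i / 2 * (norm (?P i *v d))\<^sup>2))" for d
    unfolding core_fun_def col_blk_mult_blk s_def[symmetric, unfolded col_blk_mult_blk] sqA sqP L_def
    by (simp add: sum.distrib)
  moreover have "(\<Sum>i\<in>UNIV. \<theta> i / 2 * (norm (?A i *v d))\<^sup>2) + (\<Sum>i\<in>UNIV. \<alpha> i / 2 * (norm (?P i *v d))\<^sup>2)
      = \<epsilon> / 2 * (d \<bullet> (H_mat c A P \<theta> \<alpha> \<epsilon> *v d))" for d
    using assms by (simp add: H_mat_quadratic_form sum_divide_distrib distrib_left sum_distrib_left)
  ultimately show ?thesis by (intro exI[of _ L]) auto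
qed

lemma bregman_core_fun:
  assumes "\<epsilon> \<noteq> 0"
  shows "bregman (core_fun c A b P \<theta> \<alpha> v) y x
    = \<epsilon> / 2 * ((y - x) \<bullet> (H_mat c A P \<theta> \<alpha> \<epsilon> *v (y - x)))"
proof -
  let ?H = "H_mat c A P \<theta> \<alpha> \<epsilon>"
  obtain L where L: "linear L" "\<And>d. core_fun c A b P \<theta> \<alpha> v (x + d)
      = core_fun c A b P \<theta> \<alpha> v x + L d + \<epsilon> / 2 * (d \<bullet> (?H *v d))"
    using core_fun_expansion[OF assms] by blast
  have "\<bar>\<epsilon> / 2 * (d \<bullet> (?H *v d))\<bar> \<le> (\<bar>\<epsilon>\<bar> / 2 * onorm ((*v) ?H)) * (norm d)\<^sup>2" for d
  proof -
    have "\<bar>d \<bullet> (?H *v d)\<bar> \<le> norm d * norm (?H *v d)" by (rule Cauchy_Schwarz_ineq2)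
    also have "\<dots> \<le> norm d * (onorm ((*v) ?H) * norm d)"
      by (intro mult_left_mono onorm) auto
    finally have "\<bar>d \<bullet> (?H *v d)\<bar> \<le> onorm ((*v) ?H) * (norm d)\<^sup>2"
      by (simp add: power2_eq_square algebra_simps)
    then have "\<bar>\<epsilon>\<bar> / 2 * \<bar>d \<bullet> (?H *v d)\<bar> \<le> \<bar>\<epsilon>\<bar> / 2 * (onorm ((*v) ?H) * (norm d)\<^sup>2)"
      by (intro mult_left_mono) auto
    then show ?thesis by (simp only: abs_mult abs_divide abs_numeral mult.assoc)
  qed
  from bregman_quadratic[OF L(2) L(1) this] show ?thesis .
qed

text \<open>For a quadratic the defect of convexity at the midpoint is exactly an eighth of its Hessian
form at \<open>x - y\<close>.\<close>
lemma strongly_convex_core_fun_H_mat: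
  assumes "\<epsilon> \<noteq> 0" and sc: "strongly_convex_on U \<beta> (core_fun c A b P \<theta> \<alpha> v)"
    and U: "x \<in> U" "y \<in> U"
  shows "\<beta> * (norm (x - y))\<^sup>2 \<le> \<epsilon> * ((x - y) \<bullet> (H_mat c A P \<theta> \<alpha> \<epsilon> *v (x - y)))"
proof -
  let ?H = "H_mat c A P \<theta> \<alpha> \<epsilon>" and ?K = "core_fun c A b P \<theta> \<alpha> v"
  define m where "m = (1/2) *\<^sub>R x + (1/2) *\<^sub>R y"
  define h where "h = (1/2) *\<^sub>R (x - y)"
  have xy: "x = m + h" "y = m + - h"
    by (simp_all add: m_def h_def algebra_simps flip: scaleR_add_left)
  obtain L where L: "linear L" "\<And>d. ?K (m + d) = ?K m + L d + \<epsilon> / 2 * (d \<bullet> (?H *v d))"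
    using core_fun_expansion[OF assms(1)] by blast
  have "?K m \<le> 1/2 * ?K x + 1/2 * ?K y - \<beta> / 2 * (1/2) * (1/2) * (norm (x - y))\<^sup>2"
    using sc[unfolded strongly_convex_on_def, THEN conjunct2, rule_format, OF U, of "1/2" "1/2"]
    by (simp add: m_def)
  moreover have "?K x + ?K y = 2 * ?K m + \<epsilon> * (h \<bullet> (?H *v h))"
    unfolding xy L(2) using linear_neg[OF L(1)]
    by (simp add: linear_neg[OF matrix_vector_mul_linear])
  moreover have "h \<bullet> (?H *v h) = 1/4 * ((x - y) \<bullet> (?H *v (x - y)))"
    unfolding h_def by (simp only: matrix_vector_mult_scaleR inner_scaleR_left inner_scaleR_right)
  ultimately show ?thesis by simp
qed

section \<open>From the algorithm to the abstract iteration\<close>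

lemma convex_on_ext_dom:
  assumes cvx: "ext_convex_on U J" and fin: "\<And>x. x \<in> U \<Longrightarrow> J x \<noteq> - \<infinity>"
  shows "convex_on (U \<inter> ext_dom J) (\<lambda>x. real_of_ereal (J x))"
proof -
  have real: "J x = ereal (real_of_ereal (J x))" if "x \<in> U" "J x < \<infinity>" for x
    using that fin[of x] by (cases "J x") auto
  have key: "t *\<^sub>R x + s *\<^sub>R y \<in> U \<and> J (t *\<^sub>R x + s *\<^sub>R y) < \<infinity> \<and>
      real_of_ereal (J (t *\<^sub>R x + s *\<^sub>R y)) \<le> t * real_of_ereal (J x) + s * real_of_ereal (J y)"
    if x: "x \<in> U" "J x < \<infinity>" and y: "y \<in> U" "J y < \<infinity>" and t: "0 \<le> t" "0 \<le> s" "t + s = 1" for x y t s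
  proof -
    let ?z = "t *\<^sub>R x + s *\<^sub>R y"
    have z: "?z \<in> U"
      using cvx x y t unfolding ext_convex_on_def convex_def by blast
    have "J ?z \<le> ereal t * J x + ereal s * J y"
      using cvx x y t unfolding ext_convex_on_def by blast
    also have "\<dots> = ereal (t * real_of_ereal (J x) + s * real_of_ereal (J y))"
      by (subst real[OF x], subst real[OF y]) simp
    finally have le: "J ?z \<le> ereal (t * real_of_ereal (J x) + s * real_of_ereal (J y))" .
    then have "J ?z < \<infinity>" by auto
    with le z show ?thesis using real[OF z] by (metis ereal_less_eq(3))
  qed
  show ?thesis unfolding convex_on_def convex_def ext_dom_def using key by auto
qed

text \<open>Compare the minimizer \<open>w\<close> with \<open>w + t (v - w)\<close>, divide by \<open>t\<close> and let \<open>t\<close> tend to \<open>0\<close> from the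
right. The convex function \<open>j\<close> enters through its values only, as it may be nonsmooth.\<close>
lemma arg_min_variational_inequality:
  fixes H :: "real^'n^'n"
  assumes cvx: "convex_on D j" and l: "linear l" and H: "transpose H = H"
    and w: "w \<in> D" and v: "v \<in> D"
    and min: "\<And>v. v \<in> D \<Longrightarrow> l w + j w + 1/2 * ((w - x) \<bullet> (H *v (w - x)))
                           \<le> l v + j v + 1/2 * ((v - x) \<bullet> (H *v (v - x)))"
  shows "0 \<le> l (v - w) + j v - j w + (H *v (w - x)) \<bullet> (v - w)"
proof -
  let ?h = "v - w"
  let ?s = "l ?h + j v - j w + (H *v (w - x)) \<bullet> ?h"
  let ?q = "1/2 * (?h \<bullet> (H *v ?h))"
  have "0 \<le> ?s + t * ?q" if t: "0 < t" "t < 1" for t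
  proof -
    let ?z = "(1 - t) *\<^sub>R w + t *\<^sub>R v"
    have z: "?z \<in> D" using cvx w v t unfolding convex_on_def convex_def by simp
    have jz: "j ?z \<le> (1 - t) * j w + t * j v" using cvx w v t unfolding convex_on_def by simp
    have zx: "?z - x = (w - x) + t *\<^sub>R ?h" by (simp add: algebra_simps)
    have lz: "l ?z = l w + t * l ?h"
      by (simp add: linear_add[OF l] linear_scale[OF l] linear_diff[OF l] algebra_simps)
    have "(?z - x) \<bullet> (H *v (?z - x)) = (w - x) \<bullet> (H *v (w - x))
        + 2 * t * ((H *v (w - x)) \<bullet> ?h) + t\<^sup>2 * (?h \<bullet> (H *v ?h))"
      unfolding zx using inner_symmetric_matrix[OF H, of "w - x" ?h]
      by (simp only: matrix_vector_right_distrib matrix_vector_mult_scaleR inner_add_left inner_add_right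
          inner_scaleR_left inner_scaleR_right) (simp add: power2_eq_square inner_commute distrib_left)
    with min[OF z] jz lz have "0 \<le> t * (?s + t * ?q)"
      by (simp add: algebra_simps power2_eq_square)
    then show ?thesis using t by (simp add: zero_le_mult_iff)
  qed
  then have "\<forall>\<^sub>F t in at_right 0. 0 \<le> ?s + t * ?q"
    unfolding eventually_at_right_field by (intro exI[of _ 1]) auto
  moreover have "((\<lambda>t. ?s + t * ?q) \<longlongrightarrow> ?s + 0 * ?q) (at_right 0)"
    by (intro tendsto_intros)
  ultimately have "0 \<le> ?s + 0 * ?q" by (intro tendsto_lowerbound) auto
  then show ?thesis by simp
qed

text \<open>Some point of \<open>U\<close> has a finite value, so the minimal value is finite and the comparison of
extended reals becomes one of reals.\<close>
lemma extended_arg_minD: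
  assumes min: "is_arg_min (\<lambda>v. ereal (f v) + J v + ereal (g v)) (\<lambda>v. v \<in> U) w"
    and fin: "\<And>x. x \<in> U \<Longrightarrow> J x \<noteq> - \<infinity>" and dom: "ext_dom J \<inter> U \<noteq> {}"
  shows "w \<in> U \<inter> ext_dom J"
    and "\<And>v. v \<in> U \<inter> ext_dom J \<Longrightarrow> f w + real_of_ereal (J w) + g w \<le> f v + real_of_ereal (J v) + g v"
proof -
  have wU: "w \<in> U" and le: "\<And>v. v \<in> U \<Longrightarrow> ereal (f w) + J w + ereal (g w) \<le> ereal (f v) + J v + ereal (g v)"
    using min by (auto simp: is_arg_min_def not_less)
  obtain v0 where v0: "v0 \<in> U" "J v0 < \<infinity>" using dom by (auto simp: ext_dom_def)
  have "J w < \<infinity>" using le[OF v0(1)] v0(2) by (cases "J w"; cases "J v0") auto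
  then show w: "w \<in> U \<inter> ext_dom J" using wU by (simp add: ext_dom_def)
  show "f w + real_of_ereal (J w) + g w \<le> f v + real_of_ereal (J v) + g v"
    if v: "v \<in> U \<inter> ext_dom J" for v
    using le[of v] v w fin[of v] fin[of w]
    by (cases "J w"; cases "J v") (auto simp: ext_dom_def)
qed

lemma sep_sum_not_MInfty:
  assumes "\<And>i. Js i (blk c i x) \<noteq> - \<infinity>"
  shows "sep_sum c Js x \<noteq> - \<infinity>"
proof -
  have "(\<Sum>i\<in>I. Js i (blk c i x)) \<noteq> - \<infinity>" if "finite I" for I
    using that assms by (induction I) auto
  then show ?thesis by (simp add: sep_sum_def)
qed

text \<open>An unbounded sublevel set would contain a sequence with norms tending to infinity along which
the objective stays below \<open>C\<close>, contrary to coercivity.\<close>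
lemma coercive_bounded_sublevel:
  fixes G :: "'a::real_normed_vector \<Rightarrow> real"
  assumes fin: "\<And>x. x \<in> U \<Longrightarrow> J x \<noteq> - \<infinity>"
    and coercive: "\<not> bounded U \<Longrightarrow>
      (\<forall>s :: nat \<Rightarrow> 'a. (\<forall>k. s k \<in> U) \<longrightarrow> filterlim (\<lambda>k. norm (s k)) at_top sequentially \<longrightarrow>
              ((\<lambda>k. ereal (G (s k)) + J (s k)) \<longlongrightarrow> \<infinity>) sequentially)"
  shows "bounded {x \<in> U \<inter> ext_dom J. G x + real_of_ereal (J x) \<le> C}" (is "bounded ?S")
proof (rule ccontr)
  assume unb: "\<not> bounded ?S"
  then have "\<not> bounded U" by (rule contrapos_nn) (auto elim: bounded_subset)
  have "\<forall>k. \<exists>x\<in>?S. real k < norm x" using unb by (force simp: bounded_iff not_le)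
  then obtain s where s: "\<And>k. s k \<in> ?S" "\<And>k. real k < norm (s k)" by metis
  have "filterlim (\<lambda>k. norm (s k)) at_top sequentially"
    by (rule filterlim_at_top_mono[OF filterlim_real_sequentially])
      (intro always_eventually allI less_imp_le s(2))
  then have "(\<lambda>k. ereal (G (s k)) + J (s k)) \<longlonglongrightarrow> \<infinity>"
    using coercive[OF \<open>\<not> bounded U\<close>] s(1) by blast
  then have "\<forall>\<^sub>F k in sequentially. ereal C < ereal (G (s k)) + J (s k)"
    by (rule order_tendstoD) simp
  then obtain k where k: "ereal C < ereal (G (s k)) + J (s k)"
    by (meson eventually_happens trivial_limit_sequentially)
  have "s k \<in> U" "J (s k) < \<infinity>" "G (s k) + real_of_ereal (J (s k)) \<le> C"
    using s(1)[of k] by (auto simp: ext_dom_def)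
  then show False using k fin[of "s k"] by (cases "J (s k)") auto
qed

lemma H_upper_quadratic_form:
  "x \<bullet> (H_upper H A \<gamma> *v y) = x \<bullet> (H *v y) - \<gamma> * ((A *v x) \<bullet> (A *v y))"
  by (simp add: H_upper_def matrix_vector_mult_diff_rdistrib scaleR_matrix_vector_assoc[symmetric]
      inner_diff_right inner_gram_matrix)

text \<open>Symmetry of \<open>H_lower\<close> passes to the two other matrices because they differ from it by multiples
of the identity and of a Gram matrix.\<close>
lemma psd_H_lower_imp:
  assumes "psd (H_lower H A \<gamma> B)"
  shows "transpose H = H" "transpose (H_upper H A \<gamma>) = H_upper H A \<gamma>"
    and "B * (norm x)\<^sup>2 \<le> x \<bullet> (H_upper H A \<gamma> *v x)"
proof -
  have L: "H_lower H A \<gamma> B = H_upper H A \<gamma> - B *\<^sub>R mat 1"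
    by (simp add: H_lower_def H_upper_def)
  show sym: "transpose (H_upper H A \<gamma>) = H_upper H A \<gamma>"
    using assms unfolding psd_def L by (auto simp: vec_eq_iff transpose_def mat_def split: if_splits) metis
  have "H = H_upper H A \<gamma> + \<gamma> *\<^sub>R (transpose A ** A)" by (simp add: H_upper_def)
  moreover have "transpose (H_upper H A \<gamma> + \<gamma> *\<^sub>R (transpose A ** A))
      = transpose (H_upper H A \<gamma>) + \<gamma> *\<^sub>R transpose (transpose A ** A)"
    by (simp add: vec_eq_iff transpose_def)
  ultimately show "transpose H = H" by (simp only: sym transpose_gram_matrix)
  have "0 \<le> x \<bullet> (H_lower H A \<gamma> B *v x)" using assms by (simp add: psd_def)
  then show "B * (norm x)\<^sup>2 \<le> x \<bullet> (H_upper H A \<gamma> *v x)"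
    unfolding L by (simp add: matrix_vector_mult_diff_rdistrib scaleR_matrix_vector_assoc[symmetric]
        inner_diff_right power2_norm_eq_inner)
qed

text \<open>A zero denominator is excluded by \<open>\<epsilon> > 0\<close>, as the quotient would then be zero by convention;
a negative one is excluded because a Gram matrix has \<open>lambda_max \<ge> 0\<close>.\<close>
lemma step_size_gap:
  fixes A :: "real^'n::finite^'m::finite"
  assumes "0 \<le> B" "0 < \<gamma>" "0 < \<epsilon>" and eps: "\<epsilon> < \<beta> / (B + \<gamma> * lambda_max (transpose A ** A))"
  shows "B + \<gamma> * lambda_max (transpose A ** A) < \<beta> / \<epsilon>"
proof -
  let ?l = "lambda_max (transpose A ** A)" and ?e = "axis undefined 1 :: real^'n"
  have "0 \<le> ?e \<bullet> ((transpose A ** A) *v ?e)" unfolding inner_gram_matrix by simp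
  also have "\<dots> \<le> ?l * (norm ?e)\<^sup>2"
    by (rule quadratic_form_le_lambda_max[OF transpose_gram_matrix])
  finally have "0 \<le> B + \<gamma> * ?l" using assms by simp
  moreover have "B + \<gamma> * ?l \<noteq> 0" using eps assms(3) by auto
  ultimately show ?thesis using eps assms(3) by (simp add: field_simps)
qed

section \<open>The convergence rate\<close>

theorem theorem5:
  fixes c :: "'n::finite \<Rightarrow> 'b::finite"
    and A :: "real^'n^'m::finite" and b :: "real^'m"
    and Us :: "'b \<Rightarrow> (real^'n) set" and U :: "(real^'n) set"
    and G :: "real^'n \<Rightarrow> real"
    and Js :: "'b \<Rightarrow> real^'n \<Rightarrow> ereal" and J :: "real^'n \<Rightarrow> ereal"
    and P :: "'b \<Rightarrow> real^'n^'q::finite"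
    and \<theta> \<alpha> :: "'b \<Rightarrow> real"
    and BG \<gamma> \<epsilon> \<rho> \<delta> :: real
    and \<beta> :: "nat \<Rightarrow> real"
    and K :: "nat \<Rightarrow> real^'n \<Rightarrow> real"
    and H :: "real^'n^'n"
    and u :: "nat \<Rightarrow> real^'n" and p :: "nat \<Rightarrow> real^'m"
  assumes "\<And>i. Us i \<subseteq> blk_space c i"
    and "\<And>i. convex (Us i)"
    and U_def: "U = prod_set c Us"
    and J_def: "J = sep_sum c Js"
    and "\<And>i x. x \<in> Us i \<Longrightarrow> Js i x \<noteq> - \<infinity>"
    and "\<And>i. ext_convex_on (Us i) (Js i)"
    and "ext_convex_on U J" and "lsc_on U J" and "ext_dom J \<inter> U \<noteq> {}"
    and "convex_on U G" and "\<And>x. x \<in> U \<Longrightarrow> G differentiable (at x)"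
    and "BG-lipschitz_on U (gradient G)"
    and "\<not> bounded U \<Longrightarrow>
           (\<forall>s :: nat \<Rightarrow> real^'n. (\<forall>k. s k \<in> U) \<longrightarrow> filterlim (\<lambda>k. norm (s k)) at_top sequentially \<longrightarrow>
              ((\<lambda>k. ereal (G (s k)) + J (s k)) \<longlongrightarrow> \<infinity>) sequentially)"
    and "0 \<in> interior ((\<lambda>x. A *v x - b) ` (U \<inter> ext_dom J))"
    and "\<And>i. \<theta> i \<ge> 0" and "\<And>i. \<alpha> i \<ge> 0"
    and "\<And>i. (full_col_rank_blk c i A \<and> \<theta> i > 0) \<or> (full_col_rank_blk c i (P i) \<and> \<alpha> i > 0)"
    and K_def: "\<And>k. K k = core_fun c A b P \<theta> \<alpha> (u k)"
    and "\<And>k. strongly_convex_on U (\<beta> k) (K k)"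
    and H_def: "H = H_mat c A P \<theta> \<alpha> \<epsilon>"
    and "psd (H_lower H A \<gamma> BG)"
    and "\<And>x. x \<in> U \<Longrightarrow> twice_differentiable_at G x"
    and "bounded (hessian G ` U)"
    and "vapp_al G J A b U K \<gamma> \<epsilon> \<rho> u p"
    and "\<gamma> > 0"
    and "0 < \<epsilon>" and "\<And>k. \<epsilon> < \<beta> k / (BG + \<gamma> * lambda_max (transpose A ** A))"
    and "0 < \<delta>" and "\<delta> \<le> 1" and "0 < \<rho>" and "\<rho> < (1 + \<delta>) * \<gamma>"
  shows "(\<lambda>t. (qnorm (H_upper H A \<gamma>) (u t - u (t + 1)))\<^sup>2) \<in> o(\<lambda>t. 1 / real t)
       \<and> (\<lambda>t. (norm (p t - p (t + 1)))\<^sup>2) \<in> o(\<lambda>t. 1 / real t)"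
proof -
  note J_finite' = assms(5) and cvxJ = assms(7) and dom = assms(9) and cvxG = assms(10)
    and lip = assms(12) and coercive = assms(13) and slater = assms(14)
    and strong = assms(19) and psd = assms(21) and twice = assms(22) and alg = assms(24)
    and \<gamma> = assms(25) and \<epsilon> = assms(26) and step = assms(27) and \<delta> = assms(28,29) and \<rho> = assms(30,31)
  define D where "D = U \<inter> ext_dom J"
  define j where "j x = real_of_ereal (J x)" for x
  define Q where "Q = H_upper H A \<gamma>"
  \<comment> \<open>The Hessian of the core function is the same in all iterations, so that one strong convexity
     parameter controls every step.\<close>
  define \<kappa> where "\<kappa> = \<beta> 0 / \<epsilon> - (BG + \<gamma> * lambda_max (transpose A ** A))"
  have J_finite: "J x \<noteq> - \<infinity>" if "x \<in> U" for x
    unfolding J_def using that J_finite' by (intro sep_sum_not_MInfty) (simp add: U_def prod_set_def)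
  have cvxj: "convex_on D j"
    unfolding D_def j_def[abs_def] by (rule convex_on_ext_dom[OF cvxJ J_finite])
  have H_sym: "transpose H = H" by (rule psd_H_lower_imp(1)[OF psd])
  have \<kappa>_pos: "\<kappa> > 0"
    using step_size_gap[OF lipschitz_on_nonneg[OF lip] \<gamma> \<epsilon> step[of 0]] by (simp add: \<kappa>_def)
  have u0: "u 0 \<in> U"
    and argmin: "\<And>k. is_arg_min
            (\<lambda>v. ereal (gradient G (u k) \<bullet> v) + J v
                 + ereal ((p k + \<gamma> *\<^sub>R (A *v u k - b)) \<bullet> (A *v v)
                          + 1 / \<epsilon> * bregman (K k) v (u k)))
            (\<lambda>v. v \<in> U) (u (Suc k))"
    and p_step: "\<And>k. p (Suc k) = p k + \<rho> *\<^sub>R (A *v u (Suc k) - b)"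
    using alg unfolding vapp_al_def by auto
  have u_D: "u (Suc k) \<in> D" for k
    unfolding D_def by (rule extended_arg_minD(1)[OF argmin J_finite dom])
  have min: "gradient G (u k) \<bullet> u (Suc k) + j (u (Suc k))
        + ((p k + \<gamma> *\<^sub>R (A *v u k - b)) \<bullet> (A *v u (Suc k)) + 1 / \<epsilon> * bregman (K k) (u (Suc k)) (u k))
      \<le> gradient G (u k) \<bullet> v + j v
        + ((p k + \<gamma> *\<^sub>R (A *v u k - b)) \<bullet> (A *v v) + 1 / \<epsilon> * bregman (K k) v (u k))"
    if "v \<in> D" for k v
    unfolding j_def by (rule extended_arg_minD(2)[OF argmin J_finite dom that[unfolded D_def]])
  have u_U: "u k \<in> U" for k
    using u0 u_D by (cases k) (auto simp: D_def)
  have breg: "1 / \<epsilon> * bregman (K k) v (u k) = 1/2 * ((v - u k) \<bullet> (H *v (v - u k)))" for k v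
    using \<epsilon> unfolding K_def H_def by (subst bregman_core_fun[of \<epsilon>]) auto
  have optimality: "0 \<le> gradient G (u k) \<bullet> (v - u (Suc k)) + j v - j (u (Suc k))
           + (p k + \<gamma> *\<^sub>R (A *v u (Suc k) - b)) \<bullet> (A *v (v - u (Suc k)))
           + (Q *v (u (Suc k) - u k)) \<bullet> (v - u (Suc k))" if v: "v \<in> D" for k v
  proof -
    \<comment> \<open>The algorithm uses the residual at \<open>u k\<close>; moving it to \<open>u (Suc k)\<close> costs the term
       \<open>\<gamma> A\<^sup>T A (u (Suc k) - u k)\<close> that separates \<open>H\<close> from \<open>Q\<close>.\<close>
    let ?w = "u (Suc k)" and ?x = "u k" and ?q = "p k + \<gamma> *\<^sub>R (A *v u k - b)"
    define l where "l v = gradient G ?x \<bullet> v + ?q \<bullet> (A *v v)" for v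
    have "linear l" unfolding l_def
      by (intro linearI) (simp_all add: matrix_vector_right_distrib matrix_vector_mult_scaleR
          inner_add_right distrib_left)
    moreover have "l ?w + j ?w + 1/2 * ((?w - ?x) \<bullet> (H *v (?w - ?x)))
        \<le> l v + j v + 1/2 * ((v - ?x) \<bullet> (H *v (v - ?x)))" if "v \<in> D" for v
      using min[OF that, of k] unfolding breg l_def by linarith
    ultimately have "0 \<le> l (v - ?w) + j v - j ?w + (H *v (?w - ?x)) \<bullet> (v - ?w)"
      by (intro arg_min_variational_inequality[OF cvxj _ H_sym u_D v])
    moreover have "(Q *v (?w - ?x)) \<bullet> (v - ?w)
        = (H *v (?w - ?x)) \<bullet> (v - ?w) - \<gamma> * ((A *v (?w - ?x)) \<bullet> (A *v (v - ?w)))"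
      using H_upper_quadratic_form[of "v - ?w" H A \<gamma> "?w - ?x"] by (simp add: Q_def inner_commute)
    moreover have "p k + \<gamma> *\<^sub>R (A *v ?w - b) = ?q + \<gamma> *\<^sub>R (A *v (?w - ?x))"
      by (simp add: matrix_vector_mult_diff_distrib algebra_simps)
    ultimately show ?thesis by (simp only: l_def inner_add_left inner_scaleR_left)
  qed
  interpret linearized_augmented_lagrangian U D G j A b Q BG \<kappa> \<gamma> \<rho> u p
  proof
    show "(BG + \<kappa>) * (norm (x - y))\<^sup>2 \<le> (x - y) \<bullet> (Q *v (x - y))" if "x \<in> U" "y \<in> U" for x y
    proof -
      let ?d = "x - y"
      have "\<beta> 0 * (norm ?d)\<^sup>2 \<le> \<epsilon> * (?d \<bullet> (H *v ?d))"
        unfolding H_def using \<epsilon> strong[of 0] that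
        by (intro strongly_convex_core_fun_H_mat[where U = U]) (simp_all add: K_def)
      then have "\<beta> 0 / \<epsilon> * (norm ?d)\<^sup>2 \<le> ?d \<bullet> (H *v ?d)" using \<epsilon> by (simp add: field_simps)
      moreover have "(A *v ?d) \<bullet> (A *v ?d) \<le> lambda_max (transpose A ** A) * (norm ?d)\<^sup>2"
        unfolding inner_gram_matrix[symmetric]
        by (rule quadratic_form_le_lambda_max[OF transpose_gram_matrix])
      then have "\<gamma> * ((A *v ?d) \<bullet> (A *v ?d)) \<le> \<gamma> * lambda_max (transpose A ** A) * (norm ?d)\<^sup>2"
        using \<gamma> by simp
      ultimately show ?thesis
        by (simp add: Q_def H_upper_quadratic_form \<kappa>_def left_diff_distrib)
    qed
    show "bounded {x \<in> D. G x + j x \<le> C}" for C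
      unfolding D_def j_def by (rule coercive_bounded_sublevel[OF J_finite coercive])
    show "\<rho> < 2 * \<gamma>"
    proof -
      have "(1 + \<delta>) * \<gamma> \<le> 2 * \<gamma>" using \<delta> \<gamma> by (intro mult_right_mono) auto
      then show ?thesis using \<rho> by linarith
    qed
  qed (use cvxG cvxj twice lip psd_H_lower_imp[OF psd] \<kappa>_pos slater \<gamma> \<rho> u_U u_D optimality p_step
       in \<open>simp_all add: D_def Q_def\<close>)
  show ?thesis using primal_rate dual_rate by (simp add: Q_def)
qed

end
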